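(* The map $S_{1,2}:B\to B$ is totally dissipative and ergodic with respect to Lebesgue measure on $B$.
   Context: Let $\Lambda^n=\{x\in\mathbb{R}^n : 0\leq x_1\leq\cdots\leq x_n\}$. Let $T_{1,2}:\Lambda^{3}\to\Lambda^{3}$ send $x$ to the vector obtained by arranging $x_1,\,x_2-x_1,\,x_3-x_1$ in nondecreasing order. Let $B=\{x\in\Lambda^{2} : x_2\leq 1\}$ and $p(x_1,x_2,x_3)=(x_1/x_3,\,x_2/x_3)$ (for $x_3>0$). The map $S_{1,2}:B\to B$ is defined (Lebesgue-a.e.) by $S_{1,2}\circ p=p\circ T_{1,2}$, i.e. $S_{1,2}(z_1,z_2)=p(T_{1,2}(z_1,z_2,1))$; this is well defined since $T_{1,2}$ is positively homogeneous of degree one. Ergodic means: every measurable $E\subset B$ with $S_{1,2}^{-1}(E)=E$ has zero or full Lebesgue measure. Totally dissipative is meant in the standard sense for nonsingular transformations (the conservative part is null). *)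

theory Defs
  imports "HOL-Analysis.Analysis"
begin

text \<open>The cone Lambda^3 is represented on triples real \<times> real \<times> real, Lambda^2 on pairs.\<close>

definition Bset :: "(real \<times> real) set" where
  "Bset = {z. 0 \<le> fst z \<and> fst z \<le> snd z \<and> snd z \<le> 1}"

definition T12 :: "real \<times> real \<times> real \<Rightarrow> real \<times> real \<times> real" where
  "T12 x = (let l = sort [fst x, fst (snd x) - fst x, snd (snd x) - fst x]
            in (l ! 0, l ! 1, l ! 2))"

definition proj :: "real \<times> real \<times> real \<Rightarrow> real \<times> real" where
  "proj x = (fst x / snd (snd x), fst (snd x) / snd (snd x))"

definition S12 :: "real \<times> real \<Rightarrow> real \<times> real" where
  "S12 z = proj (T12 (fst z, snd z, 1))"

definition lebB :: "(real \<times> real) measure" where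
  "lebB = restrict_space lebesgue Bset"

definition nonsingular :: "'a measure \<Rightarrow> ('a \<Rightarrow> 'a) \<Rightarrow> bool" where
  "nonsingular M f \<longleftrightarrow> f \<in> measurable M M \<and>
     (\<forall>A \<in> sets M. emeasure M A = 0 \<longrightarrow> emeasure M (f -` A \<inter> space M) = 0)"

text \<open>W is wandering: W, f^{-1}W, f^{-2}W, ... are pairwise disjoint
  (equivalently W \<inter> f^{-n} W = {} for all n \<ge> 1).\<close>
definition wandering :: "'a measure \<Rightarrow> ('a \<Rightarrow> 'a) \<Rightarrow> 'a set \<Rightarrow> bool" where
  "wandering M f W \<longleftrightarrow> W \<in> sets M \<and>
     (\<forall>n::nat. n \<ge> 1 \<longrightarrow> W \<inter> ((f ^^ n) -` W \<inter> space M) = {})"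

text \<open>Totally dissipative: the conservative part is null, i.e. no set of positive
  measure is free of wandering sets of positive measure (every set of positive
  measure contains a wandering set of positive measure).\<close>
definition totally_dissipative :: "'a measure \<Rightarrow> ('a \<Rightarrow> 'a) \<Rightarrow> bool" where
  "totally_dissipative M f \<longleftrightarrow> nonsingular M f \<and>
     (\<forall>A \<in> sets M. emeasure M A > 0 \<longrightarrow>
        (\<exists>W. W \<subseteq> A \<and> wandering M f W \<and> emeasure M W > 0))"

definition ergodic_map :: "'a measure \<Rightarrow> ('a \<Rightarrow> 'a) \<Rightarrow> bool" where
  "ergodic_map M f \<longleftrightarrow>
     (\<forall>E \<in> sets M. f -` E \<inter> space M = E \<longrightarrow>
        emeasure M E = 0 \<or> emeasure M (space M - E) = 0)"

end

theory Submission
  imports Defs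
begin

text \<open>
  Dissipativity: in homogeneous coordinates, \<open>x\<^sub>3 - x\<^sub>1 - x\<^sub>2\<close> is invariant on the region
  \<open>x\<^sub>1 + x\<^sub>2 \<le> x\<^sub>3\<close>, which is absorbing and on which the ratio \<open>(x\<^sub>1 + x\<^sub>2) / x\<^sub>3\<close> strictly
  decreases. Writing \<open>x\<^sub>i\<close> as the pair sums of \<open>y\<close>, the points never absorbed are those on which one can
  forever subtract the two smaller entries of \<open>y\<close> from the largest, that is, the Rauzy gasket. It is null
  because the Laplace transform of its cone, divided by that of the octant, is a bounded subsolution for a
  Markov chain on weights \<open>(a, b, c)\<close> with killing, and killing has probability bounded
  away from zero.

  Ergodicity: on the absorbing region the chart \<open>w = (x\<^sub>1, x\<^sub>2) / (x\<^sub>3 - x\<^sub>1 - x\<^sub>2)\<close> turns the map into the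
  subtractive Euclidean algorithm on the cone. The normalised Laplace transform of an invariant set is a
  bounded harmonic function of the Farey chain \<open>(a, b) \<mapsto> (a, a + b), (a + b, b)\<close>, uniformly continuous in
  logarithmic coordinates. A maximum principle along orbits of \<open>(a, b) \<mapsto> (b, a + k b)\<close> shows first
  that it is invariant under scaling by the eigenvalues of these maps, hence under all scalings, and then
  that it is constant. Uniqueness of Laplace transforms finishes the proof.
\<close>

section \<open>The Rauzy gasket: the functional inequality\<close>

text \<open>Both halves rest on one mechanism. Each inverse branch is a linear shear of determinant
  one, so its transpose acts on the weights of a Laplace transform, and cutting an invariant set
  along the branches gives a sum of transforms at the new weights. Dividing by the transform of the
  full cone makes the coefficients transition probabilities; with three variables they add up to
  less than one, because the three images do not fill the octant. Neither chain is controlled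
  uniformly in one step: the killing probability tends to zero when the weights degenerate, and a
  supremum need not be attained, since the weights may run off to infinity. So estimates are made
  over long runs of a single branch, where the products of probabilities telescope, and near-maxima
  are followed along orbits of fixed length whose weights keep a bounded ratio, so that the loss per
  step is uniform. Eigenvalues enter because the next pair of such an orbit is almost the eigenvalue
  times the current one: a gap between the function and its rescaling would add up along the orbit
  and violate boundedness.\<close>

lemma gasket_contract:
  fixes q :: "real \<Rightarrow> real \<Rightarrow> real \<Rightarrow> real"
  assumes sym12: "\<And>a b c. q a b c = q b a c" and sym23: "\<And>a b c. q a b c = q a c b"
    and rec: "\<And>a b c. a > 0 \<Longrightarrow> b > 0 \<Longrightarrow> c > 0 \<Longrightarrow>
      q a b c \<le> b*c/((a+b)*(a+c)) * q a (a+b) (a+c) + a*c/((a+b)*(b+c)) * q (a+b) b (b+c)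
        + a*b/((a+c)*(b+c)) * q (a+c) (b+c) c"
    and \<sigma>: "\<sigma> \<ge> 0" and le: "\<And>a b c. a > 0 \<Longrightarrow> b > 0 \<Longrightarrow> c > 0 \<Longrightarrow> q a b c \<le> \<sigma>"
    and pos: "a > 0" "b > 0" "c > 0"
  shows "q a b c \<le> 255/256 * \<sigma>"
proof -
  define g where "g = 255/256 * \<sigma>"
  \<comment> \<open>The fourth summand is the killing probability: the defect of the three weights
    from one.\<close>
  have prob: "b*c/((a+b)*(a+c)) + a*c/((a+b)*(b+c)) + a*b/((a+c)*(b+c)) + 2*a*b*c/((a+b)*(a+c)*(b+c)) = 1"
    if "a > 0" "b > 0" "c > 0" for a b c :: real
  proof -
    have "(a+b)*(a+c)*(b+c) \<noteq> 0" "a+b \<noteq> 0" "a+c \<noteq> 0" "b+c \<noteq> 0" using that by auto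
    then show ?thesis by (simp add: divide_simps) algebra
  qed
  \<comment> \<open>Follow only the branch that adds \<open>a\<close> to the other two weights. A
    single step may kill with probability of order \<open>a/b\<close> only, but about
    \<open>b/a\<close> steps fit before \<open>b\<close> doubles, and the killing accumulates to a
    constant.\<close>
  have good: "q a b c \<le> g" if "0 < a" "a \<le> b" "b \<le> c" "c \<le> 4*b" for a b c
  proof -
    \<comment> \<open>The probability of \<open>n\<close> consecutive steps on this branch, after
      telescoping.\<close>
    define P where "P n = b*c/((b+real n*a)*(c+real n*a))" for n
    have claim: "\<sigma> - q a b c \<ge> P n * (\<sigma> - q a (b+real n*a) (c+real n*a)) + \<sigma>*real n*a/(128*b)"
      if "real n * a \<le> b" for n
      using that
    proof (induction n)
      case 0
      then show ?case using \<open>0 < a\<close> \<open>a \<le> b\<close> \<open>b \<le> c\<close> by (simp add: P_def)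
    next
      case (Suc n)
      define B where "B = b+real n*a"
      define C where "C = c+real n*a"
      have na: "real n * a \<le> b" "real n * a \<ge> 0" using Suc.prems \<open>0 < a\<close> by (auto simp: algebra_simps)
      then have IH: "\<sigma> - q a b c \<ge> P n * (\<sigma> - q a B C) + \<sigma>*real n*a/(128*b)"
        using Suc.IH by (simp add: B_def C_def)
      have B: "b \<le> B" "B \<le> 2*b" and C: "c \<le> C" "C \<le> 2*c" and BC: "B \<le> C"
        using na that \<open>b \<le> c\<close> by (auto simp: B_def C_def)
      have p: "a > 0" "b > 0" "c > 0" "B > 0" "C > 0" using \<open>0 < a\<close> \<open>a \<le> b\<close> \<open>b \<le> c\<close> B C by auto
      define k where "k = 2*a*B*C/((a+B)*(a+C)*(B+C))"
      define p1 where "p1 = B*C/((a+B)*(a+C))"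
      define p2 where "p2 = a*C/((a+B)*(B+C))"
      define p3 where "p3 = a*B/((a+C)*(B+C))"
      have sum1: "p1+p2+p3+k = 1" unfolding p1_def p2_def p3_def k_def using prob[of a B C] p by simp
      have nn: "p1 \<ge> 0" "p2 \<ge> 0" "p3 \<ge> 0" unfolding p1_def p2_def p3_def using p by auto
      have "q a B C \<le> p1 * q a (a+B) (a+C) + p2 * q (a+B) B (B+C) + p3 * q (a+C) (B+C) C"
        using rec[of a B C] p unfolding p1_def p2_def p3_def by simp
      also have "\<dots> \<le> p1 * q a (a+B) (a+C) + p2 * \<sigma> + p3 * \<sigma>"
        using nn p by (intro add_mono mult_left_mono le order_refl) auto
      finally have 0: "q a B C \<le> p1 * q a (a+B) (a+C) + p2 * \<sigma> + p3 * \<sigma>" .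
      have 1: "\<sigma> - q a B C \<ge> p1*(\<sigma> - q a (a+B) (a+C)) + k*\<sigma>"
      proof -
        have "p2*\<sigma> + p3*\<sigma> = \<sigma> - p1*\<sigma> - k*\<sigma>" using sum1 by algebra
        with 0 show ?thesis by (simp add: algebra_simps)
      qed
      have Pn: "P n = b*c/(B*C)" by (simp add: P_def B_def C_def)
      have "a+B = b + real (Suc n)*a" "a+C = c + real (Suc n)*a"
        by (auto simp: B_def C_def algebra_simps)
      then have "P (Suc n) = b*c/((a+B)*(a+C))" by (simp only: P_def)
      then have PS: "P n * p1 = P (Suc n)"
        unfolding Pn p1_def using p by simp
      have Pk: "P n * k \<ge> a/(128*b)"
      proof -
        have "P n * k = 2*a*b*c/((a+B)*(a+C)*(B+C))"
          unfolding Pn k_def using p by (simp add: field_simps)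
        \<comment> \<open>The factors are at most \<open>3*b\<close>, \<open>3*c\<close> and
          \<open>4*c\<close>, leaving \<open>a/(18*c)\<close>; with \<open>c \<le> 4*b\<close> this
          is at least \<open>a/(72*b)\<close>, and 128 is a rounder constant.\<close>
        moreover have "(a+B)*(a+C)*(B+C) \<le> (3*b)*(3*c)*(4*c)"
          using p B C BC \<open>a \<le> b\<close> \<open>b \<le> c\<close> by (intro mult_mono) auto
        then have "2*a*b*c/((a+B)*(a+C)*(B+C)) \<ge> 2*a*b*c/((3*b)*(3*c)*(4*c))"
          using p by (intro divide_left_mono) (auto intro!: mult_pos_pos)
        moreover have "2*a*b*c/((3*b)*(3*c)*(4*c)) = a/(18*c)" using p by (simp add: field_simps)
        moreover have "a/(18*c) \<ge> a/(128*b)" using p \<open>c \<le> 4*b\<close> by (intro divide_left_mono) auto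
        ultimately show ?thesis by linarith
      qed
      have "P n * (\<sigma> - q a B C) \<ge> P n * (p1*(\<sigma> - q a (a+B) (a+C)) + k*\<sigma>)"
        using 1 p by (intro mult_left_mono) (auto simp: Pn)
      also have "P n * (p1*(\<sigma> - q a (a+B) (a+C)) + k*\<sigma>)
          = P (Suc n) * (\<sigma> - q a (a+B) (a+C)) + (P n*k)*\<sigma>"
        using PS by (simp add: algebra_simps)
      finally have "P n * (\<sigma> - q a B C) \<ge> P (Suc n) * (\<sigma> - q a (a+B) (a+C)) + a/(128*b)*\<sigma>"
        using mult_right_mono[OF Pk \<sigma>] by linarith
      moreover have "a+B = b + real (Suc n)*a" "a+C = c + real (Suc n)*a"
        by (auto simp: B_def C_def algebra_simps)
      moreover have "\<sigma>*real (Suc n)*a/(128*b) = \<sigma>*real n*a/(128*b) + a/(128*b)*\<sigma>"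
        using p by (simp add: field_simps)
      ultimately show ?case using IH by simp
    qed
    \<comment> \<open>\<open>N*a\<close> lies between \<open>b/2\<close> and \<open>b\<close>, so
      the accumulated killing \<open>N*a/(128*b)\<close> is at least \<open>1/256\<close>: this is
      where the contraction factor comes from.\<close>
    define N where "N = nat \<lfloor>b/a\<rfloor>"
    have ba: "b/a \<ge> 1" using that by simp
    have "\<lfloor>b/a\<rfloor> \<ge> 1" using ba by linarith
    then have N1: "real N \<le> b/a" "b/a < real N + 1" "real N \<ge> 1" unfolding N_def by linarith+
    have Na: "real N * a \<le> b" using N1 \<open>0 < a\<close> by (simp add: pos_le_divide_eq)
    have "b < (real N + 1)*a" using N1 \<open>0 < a\<close> by (simp add: pos_divide_less_eq)
    moreover have "a \<le> real N * a" using N1(3) \<open>0 < a\<close> by simp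
    ultimately have "b \<le> 2*(real N*a)" by (simp add: algebra_simps)
    then have "1/256 \<le> real N*a/(128*b)" using that by (simp add: field_simps)
    from mult_left_mono[OF this \<sigma>] have N2: "\<sigma>/256 \<le> \<sigma>*real N*a/(128*b)" by (simp add: mult_ac)
    have "P N * (\<sigma> - q a (b+real N*a) (c+real N*a)) \<ge> 0"
      unfolding P_def using that le[of a "b+real N*a" "c+real N*a"]
      by (intro mult_nonneg_nonneg divide_nonneg_nonneg) (auto simp: add_pos_nonneg)
    then show ?thesis using claim[OF Na] N2 unfolding g_def by linarith
  qed
  \<comment> \<open>The first two branches leave \<open>c - a - b\<close> unchanged while
    \<open>a + b\<close> grows by at least \<open>m\<close>, so after \<open>n\<close> rounds
    \<open>c \<le> 2*(a+b)\<close> and \<open>good\<close> applies. The third branch lands in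
    \<open>good\<close> at once, since its weights all lie between \<open>c\<close> and
    \<open>2*c\<close>.\<close>
  have max3: "q a b c \<le> g"
    if "0 < m" "m \<le> a" "m \<le> b" "a \<le> c" "b \<le> c" "c - a - b \<le> a + b + real n * m" for a b c m n
    using that
  proof (induction n arbitrary: a b c)
    case 0
    show ?case
    proof (cases "a \<le> b")
      case True then show ?thesis using 0 by (intro good) auto
    next
      case False
      then have "q b a c \<le> g" using 0 by (intro good) auto
      then show ?thesis using sym12 by metis
    qed
  next
    case (Suc n)
    have p: "a > 0" "b > 0" "c > 0" using Suc.prems by auto
    have S: "real (Suc n) * m = real n * m + m" by (simp add: algebra_simps)
    have 1: "q a (a+b) (a+c) \<le> g" using Suc.prems S by (intro Suc.IH) auto
    have 2: "q (a+b) b (b+c) \<le> g" using Suc.prems S by (intro Suc.IH) auto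
    have 3: "q (a+c) (b+c) c \<le> g"
    proof (cases "a \<le> b")
      case True
      then have "q c (a+c) (b+c) \<le> g" using p Suc.prems by (intro good) auto
      then show ?thesis using sym12 sym23 by metis
    next
      case False
      then have "q c (b+c) (a+c) \<le> g" using p Suc.prems by (intro good) auto
      then show ?thesis using sym12 sym23 by metis
    qed
    have "q a b c \<le> b*c/((a+b)*(a+c)) * q a (a+b) (a+c) + a*c/((a+b)*(b+c)) * q (a+b) b (b+c)
        + a*b/((a+c)*(b+c)) * q (a+c) (b+c) c" using rec p by simp
    also have "\<dots> \<le> b*c/((a+b)*(a+c)) * g + a*c/((a+b)*(b+c)) * g + a*b/((a+c)*(b+c)) * g"
      using p 1 2 3 by (intro add_mono mult_left_mono) auto
    also have "\<dots> = (1 - 2*a*b*c/((a+b)*(a+c)*(b+c))) * g"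
      unfolding prob[OF p, symmetric] by (simp add: algebra_simps)
    also have "\<dots> \<le> 1 * g"
      using p \<sigma> by (intro mult_right_mono) (auto simp: g_def)
    finally show ?case by simp
  qed
  have last: "q a b c \<le> g" if "0 < a" "0 < b" "a \<le> c" "b \<le> c" for a b c
  proof -
    have "\<exists>n. c - a - b < real n * min a b" using that by (intro ex_less_of_nat_mult) auto
    then obtain n where "c - a - b < real n * min a b" ..
    then show ?thesis using that by (intro max3[of "min a b" a b c n]) auto
  qed
  consider "a \<le> c \<and> b \<le> c" | "a \<le> b \<and> c \<le> b" | "b \<le> a \<and> c \<le> a" by linarith
  then have "q a b c \<le> g"
  proof cases
    case 1 then show ?thesis using pos by (intro last) auto
  next
    case 2 then have "q a c b \<le> g" using pos by (intro last) auto
    then show ?thesis using sym23 by metis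
  next
    case 3 then have "q b c a \<le> g" using pos by (intro last) auto
    then show ?thesis using sym12 sym23 by metis
  qed
  then show ?thesis by (simp add: g_def)
qed

lemma gasket_zero:
  fixes q :: "real \<Rightarrow> real \<Rightarrow> real \<Rightarrow> real"
  assumes sym12: "\<And>a b c. q a b c = q b a c" and sym23: "\<And>a b c. q a b c = q a c b"
    and rec: "\<And>a b c. a > 0 \<Longrightarrow> b > 0 \<Longrightarrow> c > 0 \<Longrightarrow>
      q a b c \<le> b*c/((a+b)*(a+c)) * q a (a+b) (a+c) + a*c/((a+b)*(b+c)) * q (a+b) b (b+c)
        + a*b/((a+c)*(b+c)) * q (a+c) (b+c) c"
    and le: "\<And>a b c. a > 0 \<Longrightarrow> b > 0 \<Longrightarrow> c > 0 \<Longrightarrow> q a b c \<le> 1"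
    and pos: "a > 0" "b > 0" "c > 0"
  shows "q a b c \<le> 0"
proof -
  have "\<forall>a b c. a > 0 \<longrightarrow> b > 0 \<longrightarrow> c > 0 \<longrightarrow> q a b c \<le> (255/256)^n" for n
  proof (induction n)
    case 0 then show ?case using le by simp
  next
    case (Suc n)
    show ?case
      using gasket_contract[of q "(255/256)^n", OF sym12 sym23 rec] Suc.IH by simp
  qed
  moreover have "(\<lambda>n. (255/256::real)^n) \<longlonglongrightarrow> 0" by (rule LIMSEQ_power_zero) simp
  ultimately show ?thesis using pos by (intro LIMSEQ_le_const) auto
qed

section \<open>Bounded harmonic functions of the Farey chain\<close>

fun cf_seq :: "real \<Rightarrow> real \<Rightarrow> real \<Rightarrow> nat \<Rightarrow> real" where
  "cf_seq k a b 0 = a"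
| "cf_seq k a b (Suc 0) = b"
| "cf_seq k a b (Suc (Suc n)) = cf_seq k a b n + k * cf_seq k a b (Suc n)"

text \<open>The positive root of \<open>x^2 = k*x + 1\<close>, the expanding eigenvalue of the
  recurrence \<open>cf_seq\<close>.\<close>

definition cf_eigen :: "real \<Rightarrow> real" where
  "cf_eigen k = (k + sqrt (k^2 + 4)) / 2"

lemma cf_eigen:
  assumes "k \<ge> 1"
  shows "cf_eigen k > 1" "cf_eigen k > k" "cf_eigen k < k + 1" "cf_eigen k * cf_eigen k = k * cf_eigen k + 1"
proof -
  have "sqrt (k^2+4) > k" using assms by (intro real_less_rsqrt) auto
  then show 1: "cf_eigen k > k" by (simp add: cf_eigen_def)
  then show "cf_eigen k > 1" using assms by simp
  have "sqrt (k^2+4) < k + 2"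
    using assms by (intro real_less_lsqrt) (auto simp: power2_eq_square algebra_simps)
  then show "cf_eigen k < k + 1" by (simp add: cf_eigen_def)
  have "sqrt (k^2+4) * sqrt (k^2+4) = k^2+4" using assms by simp
  then show "cf_eigen k * cf_eigen k = k * cf_eigen k + 1"
    unfolding cf_eigen_def by (simp add: field_simps power2_eq_square)
qed

lemma cf_seq_pos:
  assumes "a > 0" "b > 0" "k \<ge> 1"
  shows "cf_seq k a b n > 0 \<and> cf_seq k a b (Suc n) \<ge> b"
proof (induction n)
  case (Suc n)
  have "k * cf_seq k a b (Suc n) \<ge> 1 * cf_seq k a b (Suc n)"
    using Suc assms by (intro mult_right_mono) auto
  then show ?case using Suc assms unfolding cf_seq.simps by linarith
qed (use assms in auto)

text \<open>Successive ratios must stay in a range depending on \<open>k\<close> only, so that the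
  loss factor of \<open>cf_step\<close> is the same all along the orbit.\<close>

lemma cf_seq_comparable:
  assumes "a > 0" "b > 0" "k \<ge> 1" "a \<le> 2*b" "b \<le> (k+2)*a"
  shows "cf_seq k a b n \<le> 2 * cf_seq k a b (Suc n) \<and> cf_seq k a b (Suc n) \<le> (k+2) * cf_seq k a b n"
proof (induction n)
  case (Suc n)
  have p: "cf_seq k a b n > 0" "cf_seq k a b (Suc n) > 0" using cf_seq_pos[OF assms(1-3)] by blast+
  define X Y Z where "X = cf_seq k a b (Suc n)" and "Y = cf_seq k a b n" and "Z = k * X"
  have "1 * X \<le> k * X" using p assms by (intro mult_right_mono) (auto simp: X_def)
  then have "X \<le> Z" by (simp only: Z_def mult_1_left)
  moreover have "X > 0" "Y > 0" "Y \<le> 2 * X" using p Suc by (auto simp: X_def Y_def)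
  ultimately have "X \<le> 2 * Y + 2 * Z" "Y + Z \<le> Z + 2 * X" by linarith+
  then show ?case
    by (simp only: cf_seq.simps Z_def X_def[symmetric] Y_def[symmetric] distrib_right distrib_left simp_thms)
qed (use assms in auto)

text \<open>The second eigenvalue is \<open>k - \<kappa> = -1/\<kappa>\<close> for
  \<open>\<kappa> = cf_eigen k\<close>, and the deviation from the expanding eigendirection is
  multiplied by it at each step.\<close>

lemma cf_seq_ratio:
  assumes "a > 0" "b > 0" "k \<ge> 1" "a \<le> 2*b"
  shows "\<bar>cf_seq k a b (Suc n) - cf_eigen k * cf_seq k a b n\<bar> \<le> (1/cf_eigen k)^n * ((1 + 2*cf_eigen k) * b)"
proof -
  define \<kappa> where "\<kappa> = cf_eigen k"
  note K = cf_eigen[OF assms(3), folded \<kappa>_def]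
  have "\<bar>cf_seq k a b (Suc n) - \<kappa> * cf_seq k a b n\<bar> = (1/\<kappa>)^n * \<bar>b - \<kappa>*a\<bar>"
  proof (induction n)
    case (Suc n)
    have inv: "1/\<kappa> = \<kappa> - k" using K by (simp add: field_simps)
    have "(1/\<kappa>) * \<kappa> = 1" using K by simp
    then have "cf_seq k a b (Suc (Suc n)) - \<kappa> * cf_seq k a b (Suc n) = - (1/\<kappa>) * (cf_seq k a b (Suc n) - \<kappa> * cf_seq k a b n)"
      unfolding cf_seq.simps using inv by algebra
    then have "\<bar>cf_seq k a b (Suc (Suc n)) - \<kappa> * cf_seq k a b (Suc n)\<bar>
        = (1/\<kappa>) * \<bar>cf_seq k a b (Suc n) - \<kappa> * cf_seq k a b n\<bar>"
      using K by (simp add: abs_mult)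
    then show ?case using Suc by simp
  qed simp
  also have "\<bar>b - \<kappa>*a\<bar> \<le> (1 + 2*\<kappa>) * b"
  proof -
    have "0 \<le> \<kappa> * a" "\<kappa> * a \<le> \<kappa> * (2*b)" using assms K by (auto intro!: mult_left_mono)
    then show ?thesis using assms by (simp add: algebra_simps)
  qed
  finally show ?thesis using K by (simp add: \<kappa>_def mult_left_mono)
qed

text \<open>The index \<open>n0\<close> has to be known before the orbit is chosen, because
  near-maximality is available only along orbits of prescribed length. Uniformity holds since later
  terms are at least \<open>b\<close>, which turns an additive error proportional to
  \<open>b\<close> into a relative one.\<close>

lemma cf_seq_ratio_uniform:
  assumes k: "k \<ge> 1" and "\<delta> > 0"
  shows "\<exists>n0. \<forall>a b. \<forall>n\<ge>n0. a > 0 \<longrightarrow> b > 0 \<longrightarrow> a \<le> 2*b \<longrightarrow>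
     cf_seq k a b (Suc n) \<le> (1+\<delta>) * (cf_eigen k * cf_seq k a b n) \<and>
     cf_eigen k * cf_seq k a b n \<le> (1+\<delta>) * cf_seq k a b (Suc n)"
proof -
  define \<kappa> where "\<kappa> = cf_eigen k"
  note K = cf_eigen[OF k, folded \<kappa>_def]
  have "(\<lambda>n. (1/\<kappa>)^n * (1+2*\<kappa>)) \<longlonglongrightarrow> 0 * (1+2*\<kappa>)"
    using K by (intro tendsto_mult tendsto_const LIMSEQ_power_zero) auto
  then have "\<forall>\<^sub>F n in sequentially. (1/\<kappa>)^n * (1+2*\<kappa>) < \<delta>"
    using \<open>\<delta> > 0\<close> by (intro order_tendstoD) auto
  then obtain n0 where n0: "\<And>n. n \<ge> n0 \<Longrightarrow> (1/\<kappa>)^n * (1+2*\<kappa>) < \<delta>"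
    by (auto simp: eventually_sequentially)
  show ?thesis
  \<comment> \<open>The shift by one skips the initial term \<open>a\<close>, which may be smaller
    than \<open>b\<close>.\<close>
  proof (intro exI[of _ "Suc n0"] allI impI)
    fix a b :: real and n assume n: "n \<ge> Suc n0" and ab: "a > 0" "b > 0" "a \<le> 2*b"
    obtain m where m: "n = Suc m" using n by (cases n) auto
    have x: "cf_seq k a b n \<ge> b" "cf_seq k a b (Suc n) \<ge> b"
      using cf_seq_pos[OF ab(1,2) k, of m] cf_seq_pos[OF ab(1,2) k, of n] m by auto
    have "\<bar>cf_seq k a b (Suc n) - \<kappa> * cf_seq k a b n\<bar> \<le> (1/\<kappa>)^n * (1+2*\<kappa>) * b"
      using cf_seq_ratio[OF ab(1,2) k ab(3), of n] by (simp add: \<kappa>_def mult_ac)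
    also have "\<dots> \<le> \<delta> * b" using n0[of n] n ab by (intro mult_right_mono) auto
    finally have *: "\<bar>cf_seq k a b (Suc n) - \<kappa> * cf_seq k a b n\<bar> \<le> \<delta> * b" .
    have "\<delta> * b \<le> \<delta> * cf_seq k a b (Suc n)" using x \<open>\<delta> > 0\<close> by simp
    moreover have "\<delta> * b \<le> \<delta> * (\<kappa> * cf_seq k a b n)"
    proof -
      have "1 * b \<le> \<kappa> * cf_seq k a b n" using x K ab by (intro mult_mono) auto
      then show ?thesis using \<open>\<delta> > 0\<close> by simp
    qed
    ultimately show "cf_seq k a b (Suc n) \<le> (1+\<delta>) * (cf_eigen k * cf_seq k a b n) \<and>
     cf_eigen k * cf_seq k a b n \<le> (1+\<delta>) * cf_seq k a b (Suc n)"
      using * unfolding \<kappa>_def[symmetric] distrib_right by (intro conjI; linarith)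
  qed
qed

section \<open>A maximum principle for the Farey chain\<close>

locale farey_harmonic =
  fixes d :: "real \<Rightarrow> real \<Rightarrow> real" and K :: real
  assumes bounded: "a > 0 \<Longrightarrow> b > 0 \<Longrightarrow> \<bar>d a b\<bar> \<le> K"
    and sym: "a > 0 \<Longrightarrow> b > 0 \<Longrightarrow> d a b = d b a"
    and harm: "a > 0 \<Longrightarrow> b > 0 \<Longrightarrow> d a b = b/(a+b) * d a (a+b) + a/(a+b) * d (a+b) b"
begin

text \<open>For \<open>a \<le> b\<close> the chain stays on the branch \<open>(a, b + n*a)\<close>
  for \<open>n\<close> steps with probability \<open>b/(b + n*a)\<close>, which tends to zero, and
  every exit \<open>(a + B, B)\<close> has ratio between one and two. So the supremum is decided by
  such comparable pairs.\<close>

lemma le_if_comparable_le: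
  assumes s: "\<And>a b. b > 0 \<Longrightarrow> b \<le> a \<Longrightarrow> a \<le> 2*b \<Longrightarrow> d a b \<le> s"
    and "a > 0" "b > 0"
  shows "d a b \<le> s"
proof -
  have main: "d a b \<le> s" if "0 < a" "a \<le> b" for a b
  proof -
    have claim: "d a b - s \<le> b/(b+real n*a) * (d a (b+real n*a) - s)" for n
    proof (induction n)
      case 0 then show ?case using that by simp
    next
      case (Suc n)
      define B where "B = b + real n*a"
      have B: "B \<ge> a" "B > 0" "b > 0" using that unfolding B_def by (auto intro!: add_increasing2 add_pos_nonneg)
      have "d (a+B) B \<le> s" using B that by (intro s) auto
      then have "a/(a+B) * d (a+B) B \<le> a/(a+B) * s" using B that by (intro mult_left_mono) auto
      moreover have "d a B = B/(a+B) * d a (a+B) + a/(a+B) * d (a+B) B" using B that by (intro harm) auto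
      moreover have "s = B/(a+B) * s + a/(a+B) * s"
        using B that by (simp add: divide_simps) (simp add: algebra_simps)
      ultimately have "d a B - s \<le> B/(a+B) * (d a (a+B) - s)" by (simp only: right_diff_distrib)
      then have "b/B * (d a B - s) \<le> b/B * (B/(a+B) * (d a (a+B) - s))"
        using B by (intro mult_left_mono) auto
      also have "\<dots> = b/(a+B) * (d a (a+B) - s)" using B by simp
      finally have "b/B * (d a B - s) \<le> b/(a+B) * (d a (a+B) - s)" .
      moreover have "a+B = b + real (Suc n)*a" by (simp add: B_def algebra_simps)
      ultimately show ?case using Suc unfolding B_def by auto
    qed
    have "d a b - s \<le> b/(b+real n*a) * (K + \<bar>s\<bar>)" for n
    proof -
      have "b > 0" "real n*a \<ge> 0" using that by auto
      then have "b + real n*a > 0" by linarith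
      then have "d a (b+real n*a) - s \<le> K + \<bar>s\<bar>" using bounded[of a "b+real n*a"] that by linarith
      then have "b/(b+real n*a) * (d a (b+real n*a) - s) \<le> b/(b+real n*a) * (K + \<bar>s\<bar>)"
        using that \<open>b + real n*a > 0\<close> by (intro mult_left_mono) auto
      then show ?thesis using claim[of n] by linarith
    qed
    moreover have "(\<lambda>n. b/(b+real n*a) * (K+\<bar>s\<bar>)) \<longlonglongrightarrow> 0 * (K+\<bar>s\<bar>)"
    proof (intro tendsto_mult tendsto_const)
      have "filterlim (\<lambda>n. b + real n * a) at_top sequentially"
        using that by (intro filterlim_tendsto_add_at_top[OF tendsto_const]
           filterlim_at_top_mult_tendsto_pos[OF tendsto_const _ filterlim_real_sequentially]) auto
      then show "(\<lambda>n. b/(b+real n*a)) \<longlonglongrightarrow> 0"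
        by (rule real_tendsto_divide_at_top[OF tendsto_const])
    qed
    ultimately have "d a b - s \<le> 0" by (intro LIMSEQ_le_const) auto
    then show ?thesis by simp
  qed
  show ?thesis
  proof (cases "a \<le> b")
    case True then show ?thesis using main assms by auto
  next
    case False then show ?thesis using main[of b a] sym[of a b] assms by auto
  qed
qed

text \<open>A Harnack inequality: \<open>s - d\<close> is nonnegative and harmonic, and the chain
  runs from \<open>(a, b)\<close> to \<open>(a + k*b, b)\<close> with probability
  \<open>a/(a + k*b)\<close>, which is at least \<open>1/(k+1)^2\<close> because
  \<open>a + k*(k+2)*a = (k+1)^2*a\<close>.\<close>

lemma cf_step:
  assumes s: "\<And>a b. a > 0 \<Longrightarrow> b > 0 \<Longrightarrow> d a b \<le> s"
    and "a > 0" "b > 0" "a \<le> 2*b" "b \<le> (real k+2)*a"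
  shows "s - d b (a+real k*b) \<le> (real k+1)^2 * (s - d a b)"
proof -
  have claim: "s - d a b \<ge> a/(a+real n*b) * (s - d (a+real n*b) b)" for n
  proof (induction n)
    case 0 then show ?case using assms by simp
  next
    case (Suc n)
    define A where "A = a + real n*b"
    have A: "A > 0" using assms unfolding A_def by (intro add_pos_nonneg) auto
    have "b/(A+b) * d A (A+b) \<le> b/(A+b) * s" using A assms by (intro mult_left_mono s) auto
    moreover have "d A b = b/(A+b) * d A (A+b) + A/(A+b) * d (A+b) b" using A assms by (intro harm) auto
    moreover have "s = b/(A+b) * s + A/(A+b) * s"
      using A assms by (simp add: divide_simps) (simp add: algebra_simps)
    ultimately have "A/(A+b) * (s - d (A+b) b) \<le> s - d A b" by (simp only: right_diff_distrib)
    then have "a/A * (A/(A+b) * (s - d (A+b) b)) \<le> a/A * (s - d A b)"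
      using A assms by (intro mult_left_mono) auto
    moreover have "a/A * (A/(A+b) * (s - d (A+b) b)) = a/(A+b) * (s - d (A+b) b)" using A by simp
    moreover have "A+b = a + real (Suc n)*b" by (simp add: A_def algebra_simps)
    ultimately show ?case using Suc unfolding A_def by auto
  qed
  define A where "A = a + real k*b"
  have A: "A > 0" using assms unfolding A_def by (intro add_pos_nonneg) auto
  have "real k*b \<le> real k*((real k+2)*a)" using assms by (intro mult_left_mono) auto
  then have "A \<le> (real k+1)^2 * a" by (simp add: A_def power2_eq_square algebra_simps)
  then have Aa: "A/a \<le> (real k+1)^2" using assms by (simp add: pos_divide_le_eq)
  have "s - d A b = A/a * (a/A * (s - d A b))" using A assms by simp
  also have "\<dots> \<le> A/a * (s - d a b)"
    using claim[of k] A assms unfolding A_def by (intro mult_left_mono) auto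
  also have "\<dots> \<le> (real k+1)^2 * (s - d a b)"
    using Aa s[of a b] assms by (intro mult_right_mono) auto
  finally show ?thesis using sym[of b A] A assms by (simp add: A_def)
qed

text \<open>Comparable arguments lose only a bounded factor of near-maximality at each
  step of the orbit, so a near-supremum propagates along orbits of prescribed length.\<close>
lemma near_sup:
  assumes s: "\<And>a b. a > 0 \<Longrightarrow> b > 0 \<Longrightarrow> d a b \<le> s"
    and sup: "\<And>s'. (\<And>a b. a > 0 \<Longrightarrow> b > 0 \<Longrightarrow> d a b \<le> s') \<Longrightarrow> s \<le> s'"
    and "\<epsilon> > 0" and k: "k \<ge> (1::nat)"
  shows "\<exists>a b. a > 0 \<and> b > 0 \<and> a \<le> 2*b \<and> b \<le> (real k+2)*a \<and>
    (\<forall>n\<le>m. d (cf_seq k a b n) (cf_seq k a b (Suc n)) > s - \<epsilon>)"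
proof -
  define C where "C = (real k+1)^2"
  have C: "C \<ge> 1" using k by (simp add: C_def)
  \<comment> \<open>A start within \<open>\<epsilon>/C^m\<close> of the supremum survives
    \<open>m\<close> losses of the factor \<open>C\<close>.\<close>
  have "\<exists>a b. b > 0 \<and> b \<le> a \<and> a \<le> 2*b \<and> d a b > s - \<epsilon>/C^m"
  proof (rule ccontr)
    assume neg: "\<not> ?thesis"
    have "d a b \<le> s - \<epsilon>/C^m" if "b > 0" "b \<le> a" "a \<le> 2*b" for a b
      using neg that not_le by blast
    then have "d a b \<le> s - \<epsilon>/C^m" if "a > 0" "b > 0" for a b
      using that by (rule le_if_comparable_le)
    then have "s \<le> s - \<epsilon>/C^m" by (rule sup)
    moreover have "\<epsilon>/C^m > 0" using C \<open>\<epsilon> > 0\<close> by simp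
    ultimately show False by simp
  qed
  then obtain a b where ab: "b > 0" "b \<le> a" "a \<le> 2*b" "d a b > s - \<epsilon>/C^m" by blast
  have cmp: "a > 0" "b \<le> (real k+2)*a"
  proof -
    show "a > 0" using ab by simp
    then have "(real k+1)*a \<ge> 0" by simp
    moreover have "(real k+2)*a = a + (real k+1)*a" by (simp add: algebra_simps)
    ultimately show "b \<le> (real k+2)*a" using ab by linarith
  qed
  have k1: "real k \<ge> 1" using k by simp
  have it: "s - d (cf_seq k a b n) (cf_seq k a b (Suc n)) \<le> C^n * (s - d a b)" for n
  proof (induction n)
    case (Suc n)
    have "s - d (cf_seq k a b (Suc n)) (cf_seq k a b (Suc (Suc n)))
       \<le> C * (s - d (cf_seq k a b n) (cf_seq k a b (Suc n)))"
      unfolding C_def cf_seq.simps(3)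
      using cf_seq_comparable[OF cmp(1) ab(1) k1 ab(3) cmp(2), of n]
        cf_seq_pos[OF cmp(1) ab(1) k1]
      by (intro cf_step s) auto
    also have "\<dots> \<le> C * (C^n * (s - d a b))" using Suc C by (intro mult_left_mono) auto
    finally show ?case by (simp add: mult_ac)
  qed simp
  show ?thesis
  proof (rule exI[of _ a], rule exI[of _ b], intro conjI allI impI)
    fix n assume "n \<le> m"
    have "s - d (cf_seq k a b n) (cf_seq k a b (Suc n)) \<le> C^n * (s - d a b)" by (rule it)
    also have "\<dots> \<le> C^m * (s - d a b)"
      using C \<open>n \<le> m\<close> s[of a b] ab cmp by (intro mult_right_mono power_increasing) auto
    also have "\<dots> < C^m * (\<epsilon>/C^m)" using ab C by (intro mult_strict_left_mono) auto
    also have "\<dots> = \<epsilon>" using C by simp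
    finally show "d (cf_seq k a b n) (cf_seq k a b (Suc n)) > s - \<epsilon>" by simp
  qed (use ab cmp in auto)
qed

lemma sup_exists:
  "\<exists>s. (\<forall>a b. a > 0 \<longrightarrow> b > 0 \<longrightarrow> d a b \<le> s) \<and>
     (\<forall>s'. (\<forall>a b. a > 0 \<longrightarrow> b > 0 \<longrightarrow> d a b \<le> s') \<longrightarrow> s \<le> s')"
proof -
  define X where "X = {d a b | a b. a > 0 \<and> b > 0}"
  have "d 1 1 \<in> X" unfolding X_def by force
  then have "X \<noteq> {}" by blast
  moreover have "bdd_above X" unfolding X_def bdd_above_def using bounded by (auto simp: abs_le_iff intro!: exI[of _ K])
  ultimately have "d a b \<le> Sup X" if "a > 0" "b > 0" for a b
    using that by (intro cSup_upper) (auto simp: X_def)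
  moreover have "Sup X \<le> s'" if "\<forall>a b. a > 0 \<longrightarrow> b > 0 \<longrightarrow> d a b \<le> s'" for s'
    using \<open>X \<noteq> {}\<close> that by (intro cSup_least) (auto simp: X_def)
  ultimately show ?thesis by blast
qed

end

text \<open>The monotonicity conditions make \<open>q\<close> uniformly continuous in logarithmic coordinates.\<close>
locale farey_laplace =
  fixes q :: "real \<Rightarrow> real \<Rightarrow> real"
  assumes bounds: "a > 0 \<Longrightarrow> b > 0 \<Longrightarrow> 0 \<le> q a b \<and> q a b \<le> 1"
    and sym: "a > 0 \<Longrightarrow> b > 0 \<Longrightarrow> q a b = q b a"
    and harm: "a > 0 \<Longrightarrow> b > 0 \<Longrightarrow> q a b = b/(a+b) * q a (a+b) + a/(a+b) * q (a+b) b"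
    and mono: "a > 0 \<Longrightarrow> b > 0 \<Longrightarrow> a \<le> a' \<Longrightarrow> b \<le> b' \<Longrightarrow> q a' b' * (a*b) \<le> q a b * (a'*b')"
    and mono': "a > 0 \<Longrightarrow> b > 0 \<Longrightarrow> a \<le> a' \<Longrightarrow> b \<le> b' \<Longrightarrow> (1 - q a' b') * (a*b) \<le> (1 - q a b) * (a'*b')"
begin

text \<open>Passing to \<open>1 - q\<close> turns each upper bound proved below into the matching
  lower bound.\<close>

lemma complement: "farey_laplace (\<lambda>a b. 1 - q a b)"
proof
  fix a b :: real assume ab: "a > 0" "b > 0"
  have "b/(a+b) + a/(a+b) = 1" using ab by (simp add: add_divide_distrib[symmetric])
  then have "b/(a+b) * (1 - q a (a+b)) + a/(a+b) * (1 - q (a+b) b)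
     = 1 - (b/(a+b) * q a (a+b) + a/(a+b) * q (a+b) b)" by algebra
  then show "1 - q a b = b/(a+b) * (1 - q a (a+b)) + a/(a+b) * (1 - q (a+b) b)"
    using harm[OF ab] by linarith
  show "0 \<le> 1 - q a b \<and> 1 - q a b \<le> 1" using bounds[OF ab] by linarith
  show "1 - q a b = 1 - q b a" using sym[OF ab] by linarith
  fix a' b' assume "a \<le> a'" "b \<le> b'"
  then show "(1 - q a' b') * (a*b) \<le> (1 - q a b) * (a'*b')"
    and "(1 - (1 - q a' b')) * (a*b) \<le> (1 - (1 - q a b)) * (a'*b')"
    using mono[OF ab] mono'[OF ab] by simp_all
qed

text \<open>As \<open>q a b/(a*b)\<close> decreases in the weights, \<open>q\<close> grows by at
  most the factor \<open>(1+\<delta>)^2\<close>; the same for \<open>1 - q\<close> limits how far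
  \<open>q\<close> can fall.\<close>

lemma close_mono:
  assumes "a > 0" "b > 0" "a \<le> a'" "b \<le> b'" "a' \<le> (1+\<delta>)*a" "b' \<le> (1+\<delta>)*b"
  shows "\<bar>q a' b' - q a b\<bar> \<le> (1+\<delta>)^2 - 1"
proof -
  have "(1+\<delta>)*a = a + \<delta>*a" by (simp only: distrib_right mult_1_left)
  then have "\<delta>*a \<ge> 0" using assms(3,5) by linarith
  then have \<delta>: "\<delta> \<ge> 0" using assms(1) by (simp add: zero_le_mult_iff)
  have "a'*b' \<le> ((1+\<delta>)*a)*((1+\<delta>)*b)" using assms \<delta> by (intro mult_mono) auto
  then have ab: "a'*b' \<le> (1+\<delta>)^2 * (a*b)" by (simp add: power2_eq_square mult_ac)
  have e: "(1+\<delta>)^2 \<ge> 1" using \<delta> by simp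
  have gen: "r' \<le> r + ((1+\<delta>)^2 - 1)" if "r' * (a*b) \<le> r*(a'*b')" "0 \<le> r" "r \<le> 1" for r r'
  proof -
    have "r*(a'*b') \<le> r*((1+\<delta>)^2 * (a*b))" using that ab by (intro mult_left_mono) auto
    then have "r'*(a*b) \<le> (r*(1+\<delta>)^2)*(a*b)" using that(1) by (simp add: mult_ac)
    moreover have "a*b > 0" using assms by simp
    ultimately have "r' \<le> r*(1+\<delta>)^2" by (simp only: mult_le_cancel_right_pos)
    also have "\<dots> = r + r*((1+\<delta>)^2 - 1)" by (simp add: algebra_simps)
    also have "\<dots> \<le> r + 1*((1+\<delta>)^2 - 1)" using that e by (intro add_left_mono mult_right_mono) auto
    finally show ?thesis by simp
  qed
  have "q a' b' \<le> q a b + ((1+\<delta>)^2 - 1)" using mono bounds[of a b] assms by (intro gen) auto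
  moreover have "1 - q a' b' \<le> (1 - q a b) + ((1+\<delta>)^2 - 1)" using mono' bounds[of a b] assms by (intro gen) auto
  ultimately show ?thesis by linarith
qed

lemma close:
  assumes "a > 0" "b > 0" "a' > 0" "b' > 0" "\<delta> > 0"
    and "a' \<le> (1+\<delta>)*a" "b' \<le> (1+\<delta>)*b" "a \<le> (1+\<delta>)*a'" "b \<le> (1+\<delta>)*b'"
  shows "\<bar>q a' b' - q a b\<bar> \<le> 2*((1+\<delta>)^2 - 1)"
proof -
  \<comment> \<open>Two incomparable pairs are both compared with their coordinatewise
    maximum.\<close>
  have "a \<le> (1+\<delta>)*a" "b \<le> (1+\<delta>)*b" "a' \<le> (1+\<delta>)*a'" "b' \<le> (1+\<delta>)*b'" using assms by auto
  then have "\<bar>q (max a a') (max b b') - q a b\<bar> \<le> (1+\<delta>)^2 - 1"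
    "\<bar>q (max a a') (max b b') - q a' b'\<bar> \<le> (1+\<delta>)^2 - 1"
    using assms by (auto intro!: close_mono)
  moreover have "\<bar>y - x\<bar> \<le> 2*e" if "\<bar>z - x\<bar> \<le> e" "\<bar>z - y\<bar> \<le> e" for x y z e :: real using that by linarith
  ultimately show ?thesis by blast
qed

lemma modulus:
  assumes "\<epsilon> > 0"
  shows "\<exists>\<delta>>0. \<forall>a b a' b'. a > 0 \<longrightarrow> b > 0 \<longrightarrow> a' > 0 \<longrightarrow> b' > 0 \<longrightarrow>
     a' \<le> (1+\<delta>)*a \<longrightarrow> b' \<le> (1+\<delta>)*b \<longrightarrow> a \<le> (1+\<delta>)*a' \<longrightarrow> b \<le> (1+\<delta>)*b' \<longrightarrow> \<bar>q a' b' - q a b\<bar> \<le> \<epsilon>"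
proof -
  define \<delta> where "\<delta> = min 1 (\<epsilon>/6)"
  have \<delta>: "\<delta> > 0" "\<delta> \<le> 1" "6*\<delta> \<le> \<epsilon>" using assms by (auto simp: \<delta>_def)
  then have "\<delta>*\<delta> \<le> \<delta>*1" by (intro mult_left_mono) auto
  moreover have "2*((1+\<delta>)^2 - 1) = 4*\<delta> + 2*(\<delta>*\<delta>)" by (simp add: power2_eq_square algebra_simps)
  ultimately have "2*((1+\<delta>)^2 - 1) \<le> \<epsilon>" using \<delta> by linarith
  then show ?thesis using close[OF _ _ _ _ \<delta>(1)] \<delta>(1) by (intro exI[of _ \<delta>]) force
qed

text \<open>Were the supremum \<open>s\<close> of the difference positive, \<open>q\<close> would
  rise by at least \<open>s/2\<close> at each late step of an orbit on which the difference exceeds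
  \<open>3/4*s\<close>, because the next pair is nearly \<open>cf_eigen k\<close> times the present
  one. As \<open>q\<close> is bounded by one, this cannot go on.\<close>

lemma scale_eigen_le:
  assumes k: "k \<ge> (1::nat)" and "a > 0" "b > 0"
  shows "q (cf_eigen k * a) (cf_eigen k * b) \<le> q a b"
proof -
  define \<kappa> where "\<kappa> = cf_eigen k"
  have k1: "real k \<ge> 1" using k by simp
  have \<kappa>: "\<kappa> > 0" using cf_eigen[OF k1] by (simp add: \<kappa>_def)
  define d where "d a b = q (\<kappa>*a) (\<kappa>*b) - q a b" for a b
  interpret d: farey_harmonic d 1
  proof
    fix a b :: real assume ab: "a > 0" "b > 0"
    then have kab: "\<kappa>*a > 0" "\<kappa>*b > 0" using \<kappa> by auto
    show "\<bar>d a b\<bar> \<le> 1" using bounds[OF ab] bounds[OF kab] by (auto simp: d_def)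
    show "d a b = d b a" using sym[OF ab] sym[OF kab] by (auto simp: d_def)
    have e: "\<kappa>*a+\<kappa>*b = \<kappa>*(a+b)" by (simp only: distrib_left)
    have "\<kappa>*b/(\<kappa>*(a+b)) = b/(a+b)" "\<kappa>*a/(\<kappa>*(a+b)) = a/(a+b)" using \<kappa> by auto
    then have "q (\<kappa>*a) (\<kappa>*b) = b/(a+b) * q (\<kappa>*a) (\<kappa>*(a+b)) + a/(a+b) * q (\<kappa>*(a+b)) (\<kappa>*b)"
      using harm[OF kab] unfolding e by simp
    with harm[OF ab] show "d a b = b/(a+b) * d a (a+b) + a/(a+b) * d (a+b) b"
      unfolding d_def right_diff_distrib by linarith
  qed
  obtain s where s: "\<And>a b. a > 0 \<Longrightarrow> b > 0 \<Longrightarrow> d a b \<le> s"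
    "\<And>s'. (\<And>a b. a > 0 \<Longrightarrow> b > 0 \<Longrightarrow> d a b \<le> s') \<Longrightarrow> s \<le> s'"
    using d.sup_exists by blast
  have "s \<le> 0"
  proof (rule ccontr)
    assume "\<not> s \<le> 0"
    then have s0: "s > 0" by simp
    obtain \<delta> where \<delta>: "\<delta> > 0" "\<And>a b a' b'. a > 0 \<Longrightarrow> b > 0 \<Longrightarrow> a' > 0 \<Longrightarrow> b' > 0 \<Longrightarrow>
     a' \<le> (1+\<delta>)*a \<Longrightarrow> b' \<le> (1+\<delta>)*b \<Longrightarrow> a \<le> (1+\<delta>)*a' \<Longrightarrow> b \<le> (1+\<delta>)*b' \<Longrightarrow> \<bar>q a' b' - q a b\<bar> \<le> s/4"
      using modulus[of "s/4"] s0 by auto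
    obtain n0 where n0: "\<And>a b n. n \<ge> n0 \<Longrightarrow> a > 0 \<Longrightarrow> b > 0 \<Longrightarrow> a \<le> 2*b \<Longrightarrow>
       cf_seq k a b (Suc n) \<le> (1+\<delta>) * (\<kappa> * cf_seq k a b n) \<and>
       \<kappa> * cf_seq k a b n \<le> (1+\<delta>) * cf_seq k a b (Suc n)"
      using cf_seq_ratio_uniform[OF k1 \<delta>(1)] unfolding \<kappa>_def by blast
    \<comment> \<open>\<open>J\<close> rises of \<open>s/2\<close> exceed the range of
      \<open>q\<close>. The orbit is followed for \<open>n0 + J\<close> steps, since only from
      \<open>n0\<close> on is it close to the eigendirection.\<close>
    have "\<exists>J. 1 < real J * (s/2)" using s0 by (intro ex_less_of_nat_mult) auto
    then obtain J where J: "1 < real J * (s/2)" ..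
    obtain a b where ab: "a > 0" "b > 0" "a \<le> 2*b" and
      dn: "\<And>n. n \<le> n0+J \<Longrightarrow> d (cf_seq k a b n) (cf_seq k a b (Suc n)) > s - s/4"
      using d.near_sup[OF s, of "s/4" k "n0+J"] s0 k by auto
    define x where "x = cf_seq k a b"
    have x: "x n > 0" for n using cf_seq_pos[OF ab(1,2) k1] by (simp add: x_def)
    have inc: "q (x (Suc n)) (x (Suc (Suc n))) \<ge> q (x n) (x (Suc n)) + s/2" if "n \<ge> n0" "n \<le> n0+J" for n
    proof -
      have "\<bar>q (x (Suc n)) (x (Suc (Suc n))) - q (\<kappa> * x n) (\<kappa> * x (Suc n))\<bar> \<le> s/4"
        using n0[OF _ ab, of n] n0[OF _ ab, of "Suc n"] that(1) x \<kappa>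
        unfolding x_def by (intro \<delta>(2)) (auto simp del: cf_seq.simps)
      moreover have "q (\<kappa> * x n) (\<kappa> * x (Suc n)) - q (x n) (x (Suc n)) > s - s/4"
        using dn[OF that(2)] by (simp add: x_def d_def)
      ultimately show ?thesis by linarith
    qed
    have "q (x (n0+j)) (x (Suc (n0+j))) \<ge> q (x n0) (x (Suc n0)) + real j * (s/2)" if "j \<le> J" for j
      using that
    proof (induction j)
      case (Suc j)
      have "real (Suc j) * (s/2) = real j * (s/2) + s/2" by (simp add: algebra_simps)
      moreover have "q (x (n0+j)) (x (Suc (n0+j))) \<ge> q (x n0) (x (Suc n0)) + real j * (s/2)"
        using Suc by simp
      moreover have "q (x (n0+Suc j)) (x (Suc (n0+Suc j))) \<ge> q (x (n0+j)) (x (Suc (n0+j))) + s/2"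
        using inc[of "n0+j"] Suc.prems by simp
      ultimately show ?case by linarith
    qed simp
    from this[of J] J bounds[OF x[of n0] x[of "Suc n0"]] bounds[OF x[of "n0+J"] x[of "Suc (n0+J)"]]
    show False by linarith
  qed
  then have "d a b \<le> 0" using s(1)[OF assms(2,3)] by simp
  then show ?thesis by (simp add: d_def \<kappa>_def)
qed

lemma scale_eigen:
  assumes "k \<ge> (1::nat)" and "a > 0" "b > 0"
  shows "q (cf_eigen k * a) (cf_eigen k * b) = q a b"
  using scale_eigen_le[OF assms] farey_laplace.scale_eigen_le[OF complement assms] by linarith

text \<open>Quotients of consecutive eigenvalues exceed one and come arbitrarily close to one, as
  \<open>k < cf_eigen k < k + 1\<close>. Their powers therefore approximate \<open>\<rho>\<close>
  within any factor \<open>1 + \<delta>\<close>, and uniform continuity does the rest.\<close>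

lemma scale_ge_1:
  assumes "\<rho> \<ge> 1" "a > 0" "b > 0"
  shows "q (\<rho>*a) (\<rho>*b) = q a b"
proof -
  have "\<bar>q (\<rho>*a) (\<rho>*b) - q a b\<bar> \<le> 0"
  proof (rule field_le_epsilon)
    fix \<epsilon> :: real assume "\<epsilon> > 0"
    obtain \<delta> where \<delta>: "\<delta> > 0" "\<And>a b a' b'. a > 0 \<Longrightarrow> b > 0 \<Longrightarrow> a' > 0 \<Longrightarrow> b' > 0 \<Longrightarrow>
     a' \<le> (1+\<delta>)*a \<Longrightarrow> b' \<le> (1+\<delta>)*b \<Longrightarrow> a \<le> (1+\<delta>)*a' \<Longrightarrow> b \<le> (1+\<delta>)*b' \<Longrightarrow> \<bar>q a' b' - q a b\<bar> \<le> \<epsilon>"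
      using modulus[OF \<open>\<epsilon> > 0\<close>] by auto
    have "\<exists>k. 2 < real k * \<delta>" using \<delta>(1) by (intro ex_less_of_nat_mult)
    then obtain k where k0: "2 < real k * \<delta>" ..
    then have k: "k \<ge> (1::nat)" "2 < real k * \<delta>" by (cases k; simp)+
    define \<mu> where "\<mu> = cf_eigen (Suc k) / cf_eigen k"
    have k1: "real k \<ge> 1" "real (Suc k) \<ge> 1" using k by auto
    note e = cf_eigen[OF k1(1)] cf_eigen[OF k1(2)]
    have \<mu>1: "\<mu> > 1" using e by (simp add: \<mu>_def)
    have "k + 2 < (1+\<delta>) * real k" using k by (simp add: algebra_simps)
    also have "\<dots> < (1+\<delta>) * cf_eigen k" using e \<delta> by (intro mult_strict_left_mono) auto
    finally have "cf_eigen (Suc k) \<le> (1+\<delta>) * cf_eigen k" using e by simp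
    then have \<mu>2: "\<mu> \<le> 1 + \<delta>" using e by (simp add: \<mu>_def pos_divide_le_eq)
    have inv: "q (\<mu>*a) (\<mu>*b) = q a b" if "a > 0" "b > 0" for a b
    proof -
      have "q (\<mu>*a) (\<mu>*b) = q (cf_eigen k * (\<mu>*a)) (cf_eigen k * (\<mu>*b))"
        using that k \<mu>1 by (intro scale_eigen[symmetric]) auto
      also have "cf_eigen k * (\<mu>*a) = cf_eigen (Suc k) * a"
        using e by (auto simp: \<mu>_def)
      also have "cf_eigen k * (\<mu>*b) = cf_eigen (Suc k) * b"
        using e by (auto simp: \<mu>_def)
      also have "q (cf_eigen (Suc k) * a) (cf_eigen (Suc k) * b) = q a b"
        using that by (intro scale_eigen) auto
      finally show ?thesis .
    qed
    have invn: "q (\<mu>^n*a) (\<mu>^n*b) = q a b" for n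
    proof (induction n)
      case (Suc n)
      then show ?case using inv[of "\<mu>^n*a" "\<mu>^n*b"] assms \<mu>1 by (simp add: mult_ac)
    qed simp
    define n where "n = (LEAST n. \<rho> < \<mu>^n)"
    have n: "\<rho> < \<mu>^n" unfolding n_def using real_arch_pow[OF \<mu>1] by (rule LeastI_ex)
    then obtain m where m: "n = Suc m" using assms by (cases n) auto
    have "\<not> \<rho> < \<mu>^m" using not_less_Least[of m "\<lambda>n. \<rho> < \<mu>^n"] m unfolding n_def by auto
    then have "\<mu>^m \<le> \<rho>" "\<rho> \<le> \<mu> * \<mu>^m" using n m by auto
    moreover have "\<mu> * \<mu>^m \<le> (1+\<delta>) * \<mu>^m" using \<mu>1 \<mu>2 by (intro mult_right_mono) auto
    ultimately have l: "\<mu>^m \<le> \<rho>" "\<rho> \<le> (1+\<delta>) * \<mu>^m" by auto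
    moreover have "\<rho> \<le> (1+\<delta>)*\<rho>" using assms \<delta> by auto
    ultimately have l': "\<mu>^m \<le> (1+\<delta>)*\<rho>" by linarith
    have "\<bar>q (\<rho>*a) (\<rho>*b) - q (\<mu>^m*a) (\<mu>^m*b)\<bar> \<le> \<epsilon>"
    proof (rule \<delta>(2))
      show "\<rho>*a \<le> (1+\<delta>)*(\<mu>^m*a)" using mult_right_mono[OF l(2), of a] assms by (simp add: mult_ac)
      show "\<rho>*b \<le> (1+\<delta>)*(\<mu>^m*b)" using mult_right_mono[OF l(2), of b] assms by (simp add: mult_ac)
      show "\<mu>^m*a \<le> (1+\<delta>)*(\<rho>*a)" using mult_right_mono[OF l', of a] assms by (simp add: mult_ac)
      show "\<mu>^m*b \<le> (1+\<delta>)*(\<rho>*b)" using mult_right_mono[OF l', of b] assms by (simp add: mult_ac)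
    qed (use assms \<mu>1 in auto)
    then show "\<bar>q (\<rho>*a) (\<rho>*b) - q a b\<bar> \<le> 0 + \<epsilon>" using invn by simp
  qed
  then show ?thesis by simp
qed

lemma scale:
  assumes "\<rho> > 0" "a > 0" "b > 0"
  shows "q (\<rho>*a) (\<rho>*b) = q a b"
proof (cases "\<rho> \<ge> 1")
  case True then show ?thesis using scale_ge_1 assms by simp
next
  case False
  then have "q ((1/\<rho>)*(\<rho>*a)) ((1/\<rho>)*(\<rho>*b)) = q (\<rho>*a) (\<rho>*b)"
    using assms by (intro scale_ge_1) auto
  then show ?thesis using assms by simp
qed

text \<open>A near-maximal orbit with \<open>k = 1\<close> turns towards the ray of slope
  \<open>cf_eigen 1\<close>, on which \<open>q\<close> is constant by scale invariance, so that
  value is the supremum. Applied to \<open>1 - q\<close>, it is the infimum as well.\<close>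

lemma le_eigen:
  assumes ab: "a > 0" "b > 0"
  shows "q a b \<le> q 1 (cf_eigen 1)"
proof -
  define \<kappa> where "\<kappa> = cf_eigen 1"
  have \<kappa>: "\<kappa> > 0" using cf_eigen[of 1] by (simp add: \<kappa>_def)
  interpret d: farey_harmonic q 1
  proof
    fix a b :: real assume ab: "a > 0" "b > 0"
    show "\<bar>q a b\<bar> \<le> 1" using bounds[OF ab] by linarith
  qed (fact sym harm)+
  obtain s where s: "\<And>a b. a > 0 \<Longrightarrow> b > 0 \<Longrightarrow> q a b \<le> s"
    "\<And>s'. (\<And>a b. a > 0 \<Longrightarrow> b > 0 \<Longrightarrow> q a b \<le> s') \<Longrightarrow> s \<le> s'"
    using d.sup_exists by blast
  have "s \<le> q 1 \<kappa>"
  proof (rule field_le_epsilon)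
    fix \<epsilon> :: real assume "\<epsilon> > 0"
    then obtain \<delta> where \<delta>: "\<delta> > 0" "\<And>a b a' b'. a > 0 \<Longrightarrow> b > 0 \<Longrightarrow> a' > 0 \<Longrightarrow> b' > 0 \<Longrightarrow>
     a' \<le> (1+\<delta>)*a \<Longrightarrow> b' \<le> (1+\<delta>)*b \<Longrightarrow> a \<le> (1+\<delta>)*a' \<Longrightarrow> b \<le> (1+\<delta>)*b' \<Longrightarrow> \<bar>q a' b' - q a b\<bar> \<le> \<epsilon>/2"
      using modulus[of "\<epsilon>/2"] by auto
    obtain n where n: "\<And>a b. a > 0 \<Longrightarrow> b > 0 \<Longrightarrow> a \<le> 2*b \<Longrightarrow>
       cf_seq 1 a b (Suc n) \<le> (1+\<delta>) * (\<kappa> * cf_seq 1 a b n) \<and>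
       \<kappa> * cf_seq 1 a b n \<le> (1+\<delta>) * cf_seq 1 a b (Suc n)"
      using cf_seq_ratio_uniform[of 1 \<delta>, OF order_refl \<delta>(1)] unfolding \<kappa>_def by blast
    obtain a b where ab: "a > 0" "b > 0" "a \<le> 2*b" and
      qn: "q (cf_seq 1 a b n) (cf_seq 1 a b (Suc n)) > s - \<epsilon>/2"
      using d.near_sup[OF s, of "\<epsilon>/2" 1 n] \<open>\<epsilon> > 0\<close> by auto
    define x y where "x = cf_seq 1 a b n" and "y = cf_seq 1 a b (Suc n)"
    have xy: "x > 0" "y > 0" using cf_seq_pos[OF ab(1,2), of 1] by (auto simp: x_def y_def)
    have "\<bar>q x y - q x (\<kappa>*x)\<bar> \<le> \<epsilon>/2"
      using n[OF ab] xy \<kappa> \<delta>(1) unfolding x_def[symmetric] y_def[symmetric] by (intro \<delta>(2)) auto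
    moreover have "q x (\<kappa>*x) = q 1 \<kappa>" using scale[of x 1 \<kappa>] xy \<kappa> by (simp add: mult_ac)
    ultimately show "s \<le> q 1 \<kappa> + \<epsilon>" using qn unfolding x_def y_def by linarith
  qed
  then show ?thesis using s(1)[OF ab] by (simp add: \<kappa>_def)
qed

theorem is_constant:
  assumes "a > 0" "b > 0"
  shows "q a b = q 1 (cf_eigen 1)"
  using le_eigen[OF assms] farey_laplace.le_eigen[OF complement assms] by linarith

end

section \<open>The Rauzy gasket cone is null\<close>

lemma borel_measurable_fst_snd [measurable]:
  "fst \<in> borel_measurable (borel :: ('a::euclidean_space \<times> 'b::euclidean_space) measure)"
  "snd \<in> borel_measurable (borel :: ('a::euclidean_space \<times> 'b::euclidean_space) measure)"
  by (auto intro!: borel_measurable_continuous_onI continuous_intros)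

lemma nn_integral_shear_fst:
  fixes f :: "real \<times> 'b::euclidean_space \<Rightarrow> ennreal"
  assumes [measurable]: "f \<in> borel_measurable borel" "g \<in> borel_measurable borel"
  shows "(\<integral>\<^sup>+w. f (fst w + g (snd w), snd w) \<partial>lborel) = (\<integral>\<^sup>+w. f w \<partial>lborel)"
proof -
  have "(\<integral>\<^sup>+w. f (fst w + g (snd w), snd w) \<partial>lborel)
      = (\<integral>\<^sup>+y. (\<integral>\<^sup>+x. f (x + g y, y) \<partial>lborel) \<partial>lborel)"
    unfolding lborel_prod[symmetric] by (subst lborel_pair.nn_integral_snd[symmetric]) (simp_all only: lborel_prod fst_conv snd_conv, measurable)
  also have "\<dots> = (\<integral>\<^sup>+y. (\<integral>\<^sup>+x. f (x, y) \<partial>lborel) \<partial>lborel)"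
  proof (rule nn_integral_cong)
    fix y
    show "(\<integral>\<^sup>+x. f (x + g y, y) \<partial>lborel) = (\<integral>\<^sup>+x. f (x, y) \<partial>lborel)"
      by (subst nn_integral_real_affine[of "\<lambda>x. f (x, y)" 1 "g y"]) (auto simp: add.commute)
  qed
  also have "\<dots> = (\<integral>\<^sup>+w. f w \<partial>lborel)"
    unfolding lborel_prod[symmetric] by (subst lborel_pair.nn_integral_snd) (auto simp: borel_prod lborel_prod)
  finally show ?thesis .
qed

lemma nn_integral_swap:
  fixes f :: "'a::euclidean_space \<times> 'b::euclidean_space \<Rightarrow> ennreal"
  assumes [measurable]: "f \<in> borel_measurable borel"
  shows "(\<integral>\<^sup>+w. f (snd w, fst w) \<partial>lborel) = (\<integral>\<^sup>+w. f w \<partial>lborel)"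
proof -
  have "(\<integral>\<^sup>+w. f w \<partial>lborel) = (\<integral>\<^sup>+w. f w \<partial>(lborel \<Otimes>\<^sub>M lborel))"
    by (simp add: lborel_prod)
  also have "\<dots> = (\<integral>\<^sup>+w. f w \<partial>distr (lborel \<Otimes>\<^sub>M lborel) (lborel \<Otimes>\<^sub>M lborel) (\<lambda>(x, y). (y, x)))"
    by (simp only: lborel_pair.distr_pair_swap[symmetric])
  also have "\<dots> = (\<integral>\<^sup>+w. f (snd w, fst w) \<partial>lborel)"
    by (subst nn_integral_distr) (simp_all add: lborel_prod borel_prod case_prod_beta)
  finally show ?thesis by simp
qed

lemma nn_integral_shear_snd:
  fixes f :: "real \<times> real \<Rightarrow> ennreal"
  assumes [measurable]: "f \<in> borel_measurable borel"
  shows "(\<integral>\<^sup>+w. f (fst w, fst w + snd w) \<partial>lborel) = (\<integral>\<^sup>+w. f w \<partial>lborel)"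
proof -
  have m: "(\<lambda>w. f (fst w, fst w + snd w)) \<in> borel_measurable borel" "(\<lambda>w. f (snd w, fst w)) \<in> borel_measurable borel"
    by measurable
  have "(\<integral>\<^sup>+w. f (fst w, fst w + snd w) \<partial>lborel) = (\<integral>\<^sup>+w. f (snd w, snd w + fst w) \<partial>lborel)"
    using nn_integral_swap[OF m(1)] by (simp only: fst_conv snd_conv)
  also have "\<dots> = (\<integral>\<^sup>+w. f (snd w, fst w + snd w) \<partial>lborel)"
    by (simp only: add.commute)
  also have "\<dots> = (\<integral>\<^sup>+w. f (snd w, fst w) \<partial>lborel)"
    using nn_integral_shear_fst[OF m(2), of "\<lambda>y. y"] by (simp only: fst_conv snd_conv measurable_ident_sets)
  also have "\<dots> = (\<integral>\<^sup>+w. f w \<partial>lborel)"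
    by (rule nn_integral_swap) measurable
  finally show ?thesis .
qed

lemma nn_integral_swap12:
  fixes f :: "real \<times> real \<times> real \<Rightarrow> ennreal"
  assumes [measurable]: "f \<in> borel_measurable borel"
  shows "(\<integral>\<^sup>+w. f (fst (snd w), fst w, snd (snd w)) \<partial>lborel) = (\<integral>\<^sup>+w. f w \<partial>lborel)"
proof -
  have it: "(\<integral>\<^sup>+w. h w \<partial>lborel) = (\<integral>\<^sup>+x. (\<integral>\<^sup>+y. (\<integral>\<^sup>+z. h (x, y, z) \<partial>lborel) \<partial>lborel) \<partial>lborel)"
    if [measurable]: "h \<in> borel_measurable borel" for h :: "real \<times> real \<times> real \<Rightarrow> ennreal"
  proof -
    have "(\<integral>\<^sup>+w. h w \<partial>lborel) = (\<integral>\<^sup>+x. (\<integral>\<^sup>+w. h (x, w) \<partial>lborel) \<partial>lborel)"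
      unfolding lborel_prod[symmetric, where 'a=real and 'b="real \<times> real"]
      by (subst lborel.nn_integral_fst[symmetric]) (auto simp: borel_prod lborel_prod)
    also have "\<dots> = (\<integral>\<^sup>+x. (\<integral>\<^sup>+y. (\<integral>\<^sup>+z. h (x, y, z) \<partial>lborel) \<partial>lborel) \<partial>lborel)"
      unfolding lborel_prod[symmetric, where 'a=real and 'b=real]
      by (intro nn_integral_cong, subst lborel.nn_integral_fst[symmetric]) (auto simp: borel_prod lborel_prod)
    finally show ?thesis .
  qed
  have "(\<integral>\<^sup>+w. f (fst (snd w), fst w, snd (snd w)) \<partial>lborel)
      = (\<integral>\<^sup>+x. (\<integral>\<^sup>+y. (\<integral>\<^sup>+z. f (y, x, z) \<partial>lborel) \<partial>lborel) \<partial>lborel)"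
    by (subst it) auto
  also have "\<dots> = (\<integral>\<^sup>+y. (\<integral>\<^sup>+x. (\<integral>\<^sup>+z. f (y, x, z) \<partial>lborel) \<partial>lborel) \<partial>lborel)"
    by (rule lborel_pair.Fubini') (auto simp: case_prod_beta)
  also have "\<dots> = (\<integral>\<^sup>+w. f w \<partial>lborel)"
    by (subst it) auto
  finally show ?thesis .
qed

lemma nn_integral_swap23:
  fixes f :: "real \<times> real \<times> real \<Rightarrow> ennreal"
  assumes [measurable]: "f \<in> borel_measurable borel"
  shows "(\<integral>\<^sup>+w. f (fst w, snd (snd w), fst (snd w)) \<partial>lborel) = (\<integral>\<^sup>+w. f w \<partial>lborel)"
proof -
  have it: "(\<integral>\<^sup>+w. h w \<partial>lborel) = (\<integral>\<^sup>+x. (\<integral>\<^sup>+w. h (x, w) \<partial>lborel) \<partial>lborel)"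
    if [measurable]: "h \<in> borel_measurable borel" for h :: "real \<times> real \<times> real \<Rightarrow> ennreal"
    unfolding lborel_prod[symmetric, where 'a=real and 'b="real \<times> real"]
    by (subst lborel.nn_integral_fst[symmetric]) (auto simp: borel_prod lborel_prod)
  have "(\<integral>\<^sup>+w. f (fst w, snd (snd w), fst (snd w)) \<partial>lborel)
      = (\<integral>\<^sup>+x. (\<integral>\<^sup>+w. f (x, snd w, fst w) \<partial>lborel) \<partial>lborel)"
    by (subst it) auto
  also have "\<dots> = (\<integral>\<^sup>+x. (\<integral>\<^sup>+w. f (x, w) \<partial>lborel) \<partial>lborel)"
  proof (rule nn_integral_cong)
    fix x
    have "(\<lambda>w. f (x, w)) \<in> borel_measurable borel" by measurable
    from nn_integral_swap[OF this] show "(\<integral>\<^sup>+w. f (x, snd w, fst w) \<partial>lborel) = (\<integral>\<^sup>+w. f (x, w) \<partial>lborel)"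
      by simp
  qed
  also have "\<dots> = (\<integral>\<^sup>+w. f w \<partial>lborel)"
    by (subst it) auto
  finally show ?thesis .
qed

lemma nn_integral_exp_neg:
  assumes "a > 0"
  shows "(\<integral>\<^sup>+x. indicator {0<..} x * ennreal (exp (-(a*x))) \<partial>lborel) = ennreal (1/a)"
proof -
  have lim: "((\<lambda>x. - exp (-(a*x)) / a) \<longlongrightarrow> 0) at_top"
  proof -
    have "filterlim (\<lambda>x. a * x) at_top at_top"
      using assms by (intro filterlim_tendsto_pos_mult_at_top[OF tendsto_const _ filterlim_ident])
    then have "((\<lambda>x. exp (-(a*x))) \<longlongrightarrow> 0) at_top"
      by (intro filterlim_compose[OF exp_at_bot]) (simp add: filterlim_uminus_at_top[symmetric])
    from tendsto_divide[OF tendsto_minus[OF this] tendsto_const[of a]] show ?thesis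
      using assms by simp
  qed
  have "(\<integral>\<^sup>+x. ennreal (exp (-(a*x))) * indicator {0..} x \<partial>lborel) = ennreal (0 - (- exp (-(a*0)) / a))"
    using assms lim
    by (intro nn_integral_FTC_atLeast) (auto intro!: derivative_eq_intros simp: field_simps)
  also have "(\<integral>\<^sup>+x. ennreal (exp (-(a*x))) * indicator {0..} x \<partial>lborel)
      = (\<integral>\<^sup>+x. indicator {0<..} x * ennreal (exp (-(a*x))) \<partial>lborel)"
    using AE_lborel_singleton[of "0::real"]
    by (intro nn_integral_cong_AE) (auto simp: indicator_def elim!: eventually_mono)
  finally show ?thesis by simp
qed

definition octant :: "(real \<times> real \<times> real) set" where
  "octant = {0<..} \<times> {0<..} \<times> {0<..}"

definition laplace3 :: "(real \<times> real \<times> real) set \<Rightarrow> real \<Rightarrow> real \<Rightarrow> real \<Rightarrow> ennreal" where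
  "laplace3 G a b c =
     (\<integral>\<^sup>+w. indicator G w * ennreal (exp (-(a * fst w + b * fst (snd w) + c * snd (snd w)))) \<partial>lborel)"

lemma laplace3_octant:
  assumes "a > 0" "b > 0" "c > 0"
  shows "laplace3 octant a b c = ennreal (1/(a*b*c))"
proof -
  define e where "e a x = indicator {0<..} x * ennreal (exp (-(a*x)))" for a x :: real
  have [measurable]: "e a \<in> borel_measurable borel" for a unfolding e_def by measurable
  have I: "(\<integral>\<^sup>+x. e a x \<partial>lborel) = ennreal (1/a)" if "a > 0" for a
    unfolding e_def by (rule nn_integral_exp_neg[OF that])
  have "laplace3 octant a b c = (\<integral>\<^sup>+w. e a (fst w) * (e b (fst (snd w)) * e c (snd (snd w))) \<partial>lborel)"
    unfolding laplace3_def
    by (intro nn_integral_cong)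
       (auto simp: e_def octant_def indicator_def ennreal_mult[symmetric] exp_add[symmetric] mult_ac)
  also have "\<dots> = (\<integral>\<^sup>+x. (\<integral>\<^sup>+w. e a x * (e b (fst w) * e c (snd w)) \<partial>lborel) \<partial>lborel)"
    unfolding lborel_prod[symmetric, where 'a=real and 'b="real \<times> real"]
    by (subst lborel.nn_integral_fst[symmetric]) (auto simp: borel_prod lborel_prod)
  also have "\<dots> = (\<integral>\<^sup>+x. e a x * (\<integral>\<^sup>+w. (e b (fst w) * e c (snd w)) \<partial>lborel) \<partial>lborel)"
    by (intro nn_integral_cong nn_integral_cmult) measurable
  also have "\<dots> = (\<integral>\<^sup>+x. e a x \<partial>lborel) * (\<integral>\<^sup>+w. (e b (fst w) * e c (snd w)) \<partial>lborel)"
    by (rule nn_integral_multc) measurable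
  also have "(\<integral>\<^sup>+w. (e b (fst w) * e c (snd w)) \<partial>lborel) = (\<integral>\<^sup>+x. (\<integral>\<^sup>+y. e b x * e c y \<partial>lborel) \<partial>lborel)"
    unfolding lborel_prod[symmetric, where 'a=real and 'b=real]
    by (subst lborel.nn_integral_fst[symmetric]) (auto simp: borel_prod lborel_prod)
  also have "\<dots> = (\<integral>\<^sup>+x. e b x * (\<integral>\<^sup>+y. e c y \<partial>lborel) \<partial>lborel)"
    by (intro nn_integral_cong nn_integral_cmult) measurable
  also have "\<dots> = (\<integral>\<^sup>+x. e b x \<partial>lborel) * (\<integral>\<^sup>+y. e c y \<partial>lborel)"
    by (rule nn_integral_multc) measurable
  finally show ?thesis using assms by (simp add: I ennreal_mult[symmetric])
qed

text \<open>The hypotheses say that \<open>G\<close> is contained in the cone over the Rauzy gasket.\<close>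
lemma gasket_null:
  assumes G[measurable]: "G \<in> sets borel" and oct: "G \<subseteq> octant"
    and s12: "\<And>x y z. (x, y, z) \<in> G \<Longrightarrow> (y, x, z) \<in> G"
    and s23: "\<And>x y z. (x, y, z) \<in> G \<Longrightarrow> (x, z, y) \<in> G"
    and dom: "\<And>x y z. (x, y, z) \<in> G \<Longrightarrow> x > y + z \<or> y > x + z \<or> z > x + y"
    and step: "\<And>x y z. (x, y, z) \<in> G \<Longrightarrow> x > y + z \<Longrightarrow> (x - y - z, y, z) \<in> G"
  shows "G \<in> null_sets lborel"
proof -
  define e where "e a b c w = ennreal (exp (-(a * fst w + b * fst (snd w) + c * snd (snd w))))"
    for a b c :: real and w :: "real \<times> real \<times> real"
  have [measurable]: "e a b c \<in> borel_measurable borel" for a b c unfolding e_def by measurable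
  define H where "H = laplace3 G"
  have H: "H a b c = (\<integral>\<^sup>+w. indicator G w * e a b c w \<partial>lborel)" for a b c
    by (simp add: H_def laplace3_def e_def)
  have G12: "indicator G (y, x, z) = (indicator G (x, y, z) :: ennreal)" for x y z
    using s12 by (auto simp: indicator_def)
  have G23: "indicator G (x, z, y) = (indicator G (x, y, z) :: ennreal)" for x y z
    using s23 by (auto simp: indicator_def)
  have sym12: "H a b c = H b a c" for a b c
  proof -
    have "(\<lambda>w. indicator G w * e b a c w) \<in> borel_measurable borel" by measurable
    from nn_integral_swap12[OF this] show ?thesis unfolding H
      by (simp add: G12 e_def add_ac mult_ac)
  qed
  have sym23: "H a b c = H a c b" for a b c
  proof -
    have "(\<lambda>w. indicator G w * e a c b w) \<in> borel_measurable borel" by measurable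
    from nn_integral_swap23[OF this] show ?thesis unfolding H
      by (simp add: G23 e_def add_ac mult_ac)
  qed
  have bound: "H a b c \<le> ennreal (1/(a*b*c))" if "a > 0" "b > 0" "c > 0" for a b c
  proof -
    have "H a b c \<le> laplace3 octant a b c"
      unfolding H_def laplace3_def using oct
      by (intro nn_integral_mono mult_right_mono) (auto simp: indicator_def)
    then show ?thesis using laplace3_octant[OF that] by simp
  qed
  define d1 d2 d3 :: "real \<times> real \<times> real \<Rightarrow> ennreal" where
    "d1 w = (if fst w > fst (snd w) + snd (snd w) then 1 else 0)" and
    "d2 w = (if fst (snd w) > fst w + snd (snd w) then 1 else 0)" and
    "d3 w = (if snd (snd w) > fst w + fst (snd w) then 1 else 0)" for w
  note d_defs = d1_def d2_def d3_def
  have [measurable]: "d1 \<in> borel_measurable borel" "d2 \<in> borel_measurable borel" "d3 \<in> borel_measurable borel"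
    unfolding d_defs by measurable
  define K where "K a b c = (\<integral>\<^sup>+w. d1 w * (indicator G w * e a b c w) \<partial>lborel)"
    for a b c
  \<comment> \<open>Replacing \<open>x\<close> by \<open>x + (y + z)\<close> turns the exponent into
    \<open>a*x + (a+b)*y + (a+c)*z\<close>. Only one direction of the membership is available, by
    \<open>step\<close>; hence an inequality.\<close>
  have K: "K a b c \<le> H a (a+b) (a+c)" for a b c
  proof -
    define f where "f w = d1 w * (indicator G w * e a b c w)" for w
    have fm: "f \<in> borel_measurable borel" unfolding f_def by measurable
    have gm: "(\<lambda>v. fst v + snd v :: real) \<in> borel_measurable borel" by measurable
    have "K a b c = (\<integral>\<^sup>+w. f (fst w + (fst (snd w) + snd (snd w)), snd w) \<partial>lborel)"
      unfolding K_def f_def[symmetric] by (rule nn_integral_shear_fst[OF fm gm, symmetric])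
    also have "\<dots> \<le> H a (a+b) (a+c)"
      unfolding H
    proof (rule nn_integral_mono)
      fix w :: "real \<times> real \<times> real"
      obtain x y z where w: "w = (x, y, z)" by (cases w)
      have "indicator G (x + (y + z), y, z) \<le> (indicator G (x, y, z) :: ennreal)" if "x > 0"
        using step[of "x + (y + z)" y z] that by (auto simp: indicator_def)
      moreover have "e a b c (x + (y + z), y, z) = e a (a+b) (a+c) (x, y, z)"
        by (simp add: e_def algebra_simps)
      ultimately show "f (fst w + (fst (snd w) + snd (snd w)), snd w) \<le> indicator G w * e a (a+b) (a+c) w"
        unfolding w f_def by (auto simp: indicator_def d1_def)
    qed
    finally show ?thesis .
  qed
  \<comment> \<open>By \<open>dom\<close> the three regions cover \<open>G\<close>; exchanging
    coordinates reduces the last two to the first.\<close>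
  have rec: "H a b c \<le> H a (a+b) (a+c) + H (a+b) b (b+c) + H (a+c) (b+c) c" for a b c
  proof -
    have K2: "(\<integral>\<^sup>+w. d2 w * (indicator G w * e a b c w) \<partial>lborel) = K b a c"
      (is "?L = _")
    proof -
      have "(\<lambda>w. d2 w * (indicator G w * e a b c w)) \<in> borel_measurable borel"
        by measurable
      from nn_integral_swap12[OF this] show ?thesis unfolding K_def
        by (simp add: G12 e_def d_defs add_ac mult_ac)
    qed
    have K3: "(\<integral>\<^sup>+w. d3 w * (indicator G w * e a b c w) \<partial>lborel) = K c a b"
    proof -
      have m1: "(\<lambda>w. d3 w * (indicator G w * e a b c w)) \<in> borel_measurable borel"
        by measurable
      have m2: "(\<lambda>w. d2 w * (indicator G w * e a c b w)) \<in> borel_measurable borel"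
        by measurable
      show ?thesis unfolding K_def
        using nn_integral_swap12[OF m2] nn_integral_swap23[OF m1]
        by (simp add: G12 G23 e_def d_defs add_ac mult_ac)
    qed
    have "H a b c \<le> (\<integral>\<^sup>+w. d1 w * (indicator G w * e a b c w)
         + d2 w * (indicator G w * e a b c w)
         + d3 w * (indicator G w * e a b c w) \<partial>lborel)"
      unfolding H
    proof (rule nn_integral_mono)
      fix w :: "real \<times> real \<times> real"
      obtain x y z where w: "w = (x, y, z)" by (cases w)
      have "(1::ennreal) \<le> d1 w + d2 w + d3 w" if "w \<in> G"
        using dom[of x y z] that unfolding w by (auto simp: d_defs add_increasing add_increasing2)
      then have "1 * (indicator G w * e a b c w) \<le> (d1 w + d2 w + d3 w) * (indicator G w * e a b c w)"
      proof (cases "w \<in> G")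
        case True
        then show ?thesis using \<open>w \<in> G \<Longrightarrow> _\<close> by (intro mult_right_mono) auto
      qed auto
      then show "indicator G w * e a b c w \<le> d1 w * (indicator G w * e a b c w)
         + d2 w * (indicator G w * e a b c w) + d3 w * (indicator G w * e a b c w)"
        by (simp add: distrib_right)
    qed
    also have "\<dots> = K a b c + K b a c + K c a b"
      by (subst nn_integral_add, measurable, subst nn_integral_add, measurable) (simp add: K2 K3 K_def[symmetric])
    also have "\<dots> \<le> H a (a+b) (a+c) + H b (b+a) (b+c) + H c (c+a) (c+b)"
      by (intro add_mono K)
    also have "H b (b+a) (b+c) = H (a+b) b (b+c)" using sym12 by (simp add: add.commute)
    also have "H c (c+a) (c+b) = H (a+c) (b+c) c" using sym12 sym23 by (metis add.commute)
    finally show ?thesis .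
  qed
  have fin: "H a b c < top" if "a > 0" "b > 0" "c > 0" for a b c
    using bound[OF that] by (rule le_less_trans) simp
  define q where "q a b c = a*b*c * enn2real (H a b c)" for a b c
  have "q 1 1 1 \<le> 0"
  proof (rule gasket_zero[of q])
    show "q a b c = q b a c" "q a b c = q a c b" for a b c
      using sym12 sym23 unfolding q_def by (metis mult.commute, metis mult.commute mult.assoc)
    fix a b c :: real assume p: "a > 0" "b > 0" "c > 0"
    have "enn2real (H a b c) \<le> 1/(a*b*c)" using bound[OF p] p by (simp add: enn2real_leI)
    then show "q a b c \<le> 1" unfolding q_def using p by (simp add: field_simps)
    have "enn2real (H a b c) \<le> enn2real (H a (a+b) (a+c) + H (a+b) b (b+c) + H (a+c) (b+c) c)"
      using p fin by (intro enn2real_mono rec) (auto simp: add_pos_pos)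
    also have "\<dots> = enn2real (H a (a+b) (a+c)) + enn2real (H (a+b) b (b+c)) + enn2real (H (a+c) (b+c) c)"
      using p fin by (simp add: enn2real_plus add_pos_pos)
    finally have "q a b c \<le> a*b*c*enn2real (H a (a+b) (a+c)) + a*b*c*enn2real (H (a+b) b (b+c)) + a*b*c*enn2real (H (a+c) (b+c) c)"
      unfolding q_def using p by (simp flip: distrib_left)
    also have "a*b*c*enn2real (H a (a+b) (a+c)) = b*c/((a+b)*(a+c)) * q a (a+b) (a+c)"
      unfolding q_def using p by (simp add: add_pos_pos)
    also have "a*b*c*enn2real (H (a+b) b (b+c)) = a*c/((a+b)*(b+c)) * q (a+b) b (b+c)"
      unfolding q_def using p by (simp add: add_pos_pos)
    also have "a*b*c*enn2real (H (a+c) (b+c) c) = a*b/((a+c)*(b+c)) * q (a+c) (b+c) c"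
      unfolding q_def using p by (simp add: add_pos_pos)
    finally show "q a b c \<le> b*c/((a+b)*(a+c)) * q a (a+b) (a+c) + a*c/((a+b)*(b+c)) * q (a+b) b (b+c)
        + a*b/((a+c)*(b+c)) * q (a+c) (b+c) c" .
  qed simp_all
  \<comment> \<open>Vanishing at a single weight is enough, because the exponential is positive
    everywhere.\<close>
  then have "enn2real (H 1 1 1) = 0" unfolding q_def using enn2real_nonneg[of "H 1 1 1"] by simp
  then have "H 1 1 1 = 0" using fin[of 1 1 1] by (auto simp: enn2real_eq_0_iff)
  then have "AE w in lborel. indicator G w * e 1 1 1 w = 0"
    unfolding H by (subst (asm) nn_integral_0_iff_AE) auto
  then have "AE w in lborel. w \<notin> G"
    by (rule AE_mp) (auto simp: e_def indicator_def)
  then show ?thesis by (subst (asm) AE_iff_null_sets[symmetric]) auto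
qed

section \<open>Laplace transforms of invariant sets\<close>

definition quadrant :: "(real \<times> real) set" where
  "quadrant = {0<..} \<times> {0<..}"

lemma quadrant_borel [measurable]: "quadrant \<in> sets borel"
  unfolding quadrant_def by (intro borel_open open_Times) auto

definition laplace2 :: "(real \<times> real) set \<Rightarrow> real \<Rightarrow> real \<Rightarrow> ennreal" where
  "laplace2 E a b = (\<integral>\<^sup>+w. indicator E w * ennreal (exp (-(a * fst w + b * snd w))) \<partial>lborel)"

lemma laplace2_quadrant:
  assumes "a > 0" "b > 0"
  shows "laplace2 quadrant a b = ennreal (1/(a*b))"
proof -
  define e where "e a x = indicator {0<..} x * ennreal (exp (-(a*x)))" for a x :: real
  have [measurable]: "e a \<in> borel_measurable borel" for a unfolding e_def by measurable
  have I: "(\<integral>\<^sup>+x. e a x \<partial>lborel) = ennreal (1/a)" if "a > 0" for a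
    unfolding e_def by (rule nn_integral_exp_neg[OF that])
  have "laplace2 quadrant a b = (\<integral>\<^sup>+w. e a (fst w) * e b (snd w) \<partial>lborel)"
    unfolding laplace2_def
    by (intro nn_integral_cong)
       (auto simp: e_def quadrant_def indicator_def ennreal_mult[symmetric] exp_add[symmetric] mult_ac)
  also have "\<dots> = (\<integral>\<^sup>+x. (\<integral>\<^sup>+y. e a x * e b y \<partial>lborel) \<partial>lborel)"
    unfolding lborel_prod[symmetric, where 'a=real and 'b=real]
    by (subst lborel.nn_integral_fst[symmetric]) (auto simp: borel_prod lborel_prod)
  also have "\<dots> = (\<integral>\<^sup>+x. e a x * (\<integral>\<^sup>+y. e b y \<partial>lborel) \<partial>lborel)"
    by (intro nn_integral_cong nn_integral_cmult) measurable
  also have "\<dots> = (\<integral>\<^sup>+x. e a x \<partial>lborel) * (\<integral>\<^sup>+y. e b y \<partial>lborel)"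
    by (rule nn_integral_multc) measurable
  finally show ?thesis using assms by (simp add: I ennreal_mult[symmetric])
qed

lemma laplace2_antimono:
  assumes "E \<subseteq> quadrant" "a \<le> a'" "b \<le> b'"
  shows "laplace2 E a' b' \<le> laplace2 E a b"
  unfolding laplace2_def
proof (rule nn_integral_mono)
  fix w :: "real \<times> real"
  have "a * fst w + b * snd w \<le> a' * fst w + b' * snd w" if "w \<in> E"
    using that assms by (intro add_mono mult_right_mono) (auto simp: quadrant_def)
  then show "indicator E w * ennreal (exp (-(a' * fst w + b' * snd w)))
     \<le> indicator E w * ennreal (exp (-(a * fst w + b * snd w)))"
    by (auto simp: indicator_def intro!: ennreal_leI)
qed

lemma laplace2_complement:
  assumes [measurable]: "E \<in> sets borel" and E: "E \<subseteq> quadrant" and ab: "a > 0" "b > 0"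
  shows "laplace2 E a b + laplace2 (quadrant - E) a b = ennreal (1/(a*b))"
proof -
  have "laplace2 E a b + laplace2 (quadrant - E) a b
     = (\<integral>\<^sup>+w. indicator E w * ennreal (exp (-(a * fst w + b * snd w)))
         + indicator (quadrant - E) w * ennreal (exp (-(a * fst w + b * snd w))) \<partial>lborel)"
    unfolding laplace2_def by (rule nn_integral_add[symmetric]) measurable
  also have "\<dots> = laplace2 quadrant a b"
    unfolding laplace2_def using E by (intro nn_integral_cong) (auto simp: indicator_def)
  finally show ?thesis using laplace2_quadrant[OF ab] by simp
qed

text \<open>Off the null diagonal the quadrant splits into two halves. The shear to
  \<open>(x, x + y)\<close> carries the quadrant onto the half \<open>x < y\<close> and changes the
  weights to \<open>(a + b, b)\<close>, while invariance identifies the pulled-back set with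
  \<open>E\<close> almost everywhere; exchanging coordinates treats the other half.\<close>

lemma laplace2_harmonic:
  assumes E[measurable]: "E \<in> sets borel" and sub: "E \<subseteq> quadrant"
    and swap: "\<And>x y. (x, y) \<in> E \<Longrightarrow> (y, x) \<in> E"
    and inv: "AE u in lborel. u \<in> quadrant \<longrightarrow> ((fst u, fst u + snd u) \<in> E \<longleftrightarrow> u \<in> E)"
  shows "laplace2 E a b = laplace2 E b a"
    and "laplace2 E a b = laplace2 E a (a+b) + laplace2 E (a+b) b"
proof -
  define e where "e a b w = ennreal (exp (-(a * fst w + b * snd w)))" for a b :: real and w :: "real \<times> real"
  have [measurable]: "e a b \<in> borel_measurable borel" for a b unfolding e_def by measurable
  have L: "laplace2 E a b = (\<integral>\<^sup>+w. indicator E w * e a b w \<partial>lborel)" for a b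
    by (simp add: laplace2_def e_def)
  have S: "indicator E (y, x) = (indicator E (x, y) :: ennreal)" for x y
    using swap by (auto simp: indicator_def)
  show sym: "laplace2 E a b = laplace2 E b a" for a b
  proof -
    have "(\<lambda>w. indicator E w * e b a w) \<in> borel_measurable borel" by measurable
    from nn_integral_swap[OF this] show ?thesis unfolding L
      by (simp add: S e_def add_ac)
  qed
  define d1 d2 :: "real \<times> real \<Rightarrow> ennreal" where
    "d1 w = (if fst w < snd w then 1 else 0)" and "d2 w = (if snd w < fst w then 1 else 0)" for w
  have [measurable]: "d1 \<in> borel_measurable borel" "d2 \<in> borel_measurable borel"
    unfolding d1_def d2_def by measurable
  define K where "K a b = (\<integral>\<^sup>+w. d1 w * (indicator E w * e a b w) \<partial>lborel)" for a b
  have K: "K a b = laplace2 E (a+b) b" for a b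
  proof -
    define f where "f w = d1 w * (indicator E w * e a b w)" for w
    have "f \<in> borel_measurable borel" unfolding f_def by measurable
    then have "K a b = (\<integral>\<^sup>+w. f (fst w, fst w + snd w) \<partial>lborel)"
      unfolding K_def f_def[symmetric] by (rule nn_integral_shear_snd[symmetric])
    also have "\<dots> = laplace2 E (a+b) b"
      unfolding L
    proof (rule nn_integral_cong_AE, rule AE_mp[OF inv], rule AE_I2, rule impI)
      fix u assume u: "u \<in> quadrant \<longrightarrow> ((fst u, fst u + snd u) \<in> E \<longleftrightarrow> u \<in> E)"
      have e: "e a b (fst u, fst u + snd u) = e (a+b) b u"
        by (simp add: e_def algebra_simps)
      show "f (fst u, fst u + snd u) = indicator E u * e (a+b) b u"
      proof (cases "u \<in> quadrant")
        case True
        then show ?thesis using u e by (auto simp: f_def d1_def indicator_def quadrant_def mem_Times_iff)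
      next
        case False
        then have "u \<notin> E" using sub by auto
        moreover have "\<not> ((fst u, fst u + snd u) \<in> E \<and> snd u > 0)"
          using False subsetD[OF sub, of "(fst u, fst u + snd u)"]
          by (auto simp: quadrant_def mem_Times_iff)
        ultimately show ?thesis by (auto simp: f_def d1_def indicator_def)
      qed
    qed
    finally show ?thesis .
  qed
  have K2: "(\<integral>\<^sup>+w. d2 w * (indicator E w * e a b w) \<partial>lborel) = K b a"
  proof -
    have "(\<lambda>w. d2 w * (indicator E w * e a b w)) \<in> borel_measurable borel" by measurable
    from nn_integral_swap[OF this] show ?thesis unfolding K_def
      by (simp add: S e_def d1_def d2_def add_ac)
  qed
  have "{w :: real \<times> real. fst w = snd w} = {w. (1, -1) \<bullet> w = 0}" by (auto simp: inner_prod_def)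
  then have "negligible {w :: real \<times> real. fst w = snd w}"
    using negligible_hyperplane[of "(1, -1) :: real \<times> real" 0] by (simp add: zero_prod_def)
  moreover have "closed {w :: real \<times> real. fst w = snd w}"
    by (intro closed_Collect_eq continuous_intros)
  ultimately have "{w :: real \<times> real. fst w = snd w} \<in> null_sets lborel"
    by (simp add: negligible_iff_null_sets null_sets_completion_iff)
  then have diag: "AE w in lborel. fst w \<noteq> (snd w :: real)"
    by (rule AE_not_in[THEN AE_mp]) simp
  have "laplace2 E a b = (\<integral>\<^sup>+w. d1 w * (indicator E w * e a b w) + d2 w * (indicator E w * e a b w) \<partial>lborel)"
    unfolding L
    by (rule nn_integral_cong_AE, rule AE_mp[OF diag], rule AE_I2) (auto simp: d1_def d2_def)
  also have "\<dots> = K a b + K b a"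
    by (subst nn_integral_add) (measurable, simp only: K2, simp only: K_def)
  also have "\<dots> = laplace2 E a (a+b) + laplace2 E (a+b) b"
    unfolding K using sym by (simp add: add.commute)
  finally show "laplace2 E a b = laplace2 E a (a+b) + laplace2 E (a+b) b" .
qed

text \<open>Multiplied by \<open>a*b\<close>, the transform satisfies \<open>farey_laplace\<close>:
  additivity becomes harmonicity, and the two monotonicity conditions hold because the transforms of
  \<open>E\<close> and of its complement both decrease in the weights.\<close>

lemma laplace2_invariant_constant:
  assumes E[measurable]: "E \<in> sets borel" and sub: "E \<subseteq> quadrant"
    and swap: "\<And>x y. (x, y) \<in> E \<Longrightarrow> (y, x) \<in> E"
    and inv: "AE u in lborel. u \<in> quadrant \<longrightarrow> ((fst u, fst u + snd u) \<in> E \<longleftrightarrow> u \<in> E)"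
  obtains c where "0 \<le> c" "c \<le> 1" "\<And>a b. a > 0 \<Longrightarrow> b > 0 \<Longrightarrow> laplace2 E a b = ennreal (c/(a*b))"
proof -
  define h where "h a b = enn2real (laplace2 E a b)" for a b
  define k where "k a b = enn2real (laplace2 (quadrant - E) a b)" for a b
  define q where "q a b = a*b*h a b" for a b
  have fin: "laplace2 E a b < top" "laplace2 (quadrant - E) a b < top" if "a > 0" "b > 0" for a b
  proof -
    have "laplace2 E a b \<le> ennreal (1/(a*b))" "laplace2 (quadrant - E) a b \<le> ennreal (1/(a*b))"
      unfolding laplace2_complement[OF E sub that, symmetric] by simp_all
    then show "laplace2 E a b < top" "laplace2 (quadrant - E) a b < top"
      by (auto intro: le_less_trans)
  qed
  have hk: "h a b + k a b = 1/(a*b)" if "a > 0" "b > 0" for a b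
  proof -
    have "h a b + k a b = enn2real (laplace2 E a b + laplace2 (quadrant - E) a b)"
      unfolding h_def k_def using fin[OF that] by (simp add: enn2real_plus)
    then show ?thesis using laplace2_complement[OF E sub that] that by simp
  qed
  have nn: "h a b \<ge> 0" "k a b \<ge> 0" for a b by (simp_all add: h_def k_def)
  have q1: "1 - q a b = a*b*k a b" if "a > 0" "b > 0" for a b
  proof -
    have "a*b*(h a b + k a b) = 1" using hk[OF that] that by simp
    then show ?thesis by (simp add: q_def algebra_simps)
  qed
  have mono_aux: "(a'*b'*f') * (a*b) \<le> (a*b*f) * (a'*b')" if "a > 0" "b > 0" "a \<le> a'" "b \<le> b'" "f' \<le> f"
    for a b a' b' f f' :: real
  proof -
    have "(a'*b'*(a*b)) * f' \<le> (a'*b'*(a*b)) * f" using that by (intro mult_left_mono) auto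
    then show ?thesis by (simp add: mult_ac)
  qed
  interpret q: farey_laplace q
  proof
    fix a b :: real assume ab: "a > 0" "b > 0"
    have "q a b \<ge> 0" unfolding q_def using nn ab by simp
    moreover have "1 - q a b \<ge> 0" unfolding q1[OF ab] using nn ab by simp
    ultimately show "0 \<le> q a b \<and> q a b \<le> 1" by simp
    have "laplace2 E a b = laplace2 E b a" by (rule laplace2_harmonic(1)[OF E sub swap inv])
    then show "q a b = q b a" by (simp add: q_def h_def)
    have "laplace2 E a b = laplace2 E a (a+b) + laplace2 E (a+b) b"
      by (rule laplace2_harmonic(2)[OF E sub swap inv])
    then have "h a b = h a (a+b) + h (a+b) b"
      using ab fin by (simp add: h_def enn2real_plus add_pos_pos)
    then have "q a b = a*b*h a (a+b) + a*b*h (a+b) b" by (simp add: q_def distrib_left)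
    also have "a*b*h a (a+b) = b/(a+b) * q a (a+b)" using ab by (simp add: q_def)
    also have "a*b*h (a+b) b = a/(a+b) * q (a+b) b" using ab by (simp add: q_def)
    finally show "q a b = b/(a+b) * q a (a+b) + a/(a+b) * q (a+b) b" .
    fix a' b' assume le: "a \<le> a'" "b \<le> b'"
    then have ab': "a' > 0" "b' > 0" using ab by auto
    have "h a' b' \<le> h a b" unfolding h_def
      using le sub fin[OF ab] by (intro enn2real_mono laplace2_antimono) auto
    then show "q a' b' * (a*b) \<le> q a b * (a'*b')" unfolding q_def using ab le by (intro mono_aux)
    have "k a' b' \<le> k a b" unfolding k_def
      using le fin[OF ab] by (intro enn2real_mono laplace2_antimono) auto
    then show "(1 - q a' b') * (a*b) \<le> (1 - q a b) * (a'*b')"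
      unfolding q1[OF ab] q1[OF ab'] using ab le by (intro mono_aux)
  qed
  define c where "c = q 1 (cf_eigen 1)"
  have c: "q a b = c" if "a > 0" "b > 0" for a b unfolding c_def using that by (rule q.is_constant)
  show ?thesis
  proof (rule that[of c])
    show "0 \<le> c" "c \<le> 1" using q.bounds[of 1 1] c[of 1 1] by auto
    fix a b :: real assume ab: "a > 0" "b > 0"
    then have "h a b = c/(a*b)" using c[OF ab] by (simp add: q_def field_simps)
    then show "laplace2 E a b = ennreal (c/(a*b))"
      using fin[OF ab] unfolding h_def by (metis ennreal_enn2real)
  qed
qed

section \<open>Uniqueness of Laplace transforms\<close>

text \<open>A normal form for polynomials in two variables in which equality of moments extends to
  all polynomials by linearity.\<close>

inductive bimonomial_sum :: "(real \<times> real \<Rightarrow> real) \<Rightarrow> bool" where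
  monom: "bimonomial_sum (\<lambda>z. c * (fst z ^ m * snd z ^ n))"
| add: "bimonomial_sum p \<Longrightarrow> bimonomial_sum q \<Longrightarrow> bimonomial_sum (\<lambda>z. p z + q z)"

lemma bimonomial_sum_mult:
  assumes "bimonomial_sum p" "bimonomial_sum q"
  shows "bimonomial_sum (\<lambda>z. p z * q z)"
  using assms
proof (induction p)
  case (monom c m n)
  from monom show ?case
  proof (induction q)
    case (monom c' m' n')
    have "bimonomial_sum (\<lambda>z. (c*c') * (fst z ^ (m+m') * snd z ^ (n+n')))" by (rule bimonomial_sum.monom)
    then show ?case by (simp add: power_add mult_ac)
  next
    case (add p q)
    then show ?case using bimonomial_sum.add by (simp add: distrib_left)
  qed
next
  case (add p p')
  then show ?case using bimonomial_sum.add by (simp add: distrib_right)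
qed

lemma real_polynomial_function_bimonomial_sum:
  assumes "real_polynomial_function (p :: real \<times> real \<Rightarrow> real)"
  shows "bimonomial_sum p"
  using assms
proof induction
  case (linear f)
  have "f = (\<lambda>z. f (1, 0) * fst z + f (0, 1) * snd z)"
  proof
    fix z
    interpret f: bounded_linear f by (rule linear)
    have "f (fst z *\<^sub>R (1, 0) + snd z *\<^sub>R (0, 1)) = f (1, 0) * fst z + f (0, 1) * snd z"
      by (simp only: f.add f.scaleR real_scaleR_def mult.commute)
    then show "f z = f (1, 0) * fst z + f (0, 1) * snd z" by simp
  qed
  moreover have "bimonomial_sum (\<lambda>z. f (1, 0) * (fst z ^ 1 * snd z ^ 0) + f (0, 1) * (fst z ^ 0 * snd z ^ 1))"
    by (intro bimonomial_sum.intros)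
  ultimately show ?case by simp
next
  case (const c)
  show ?case using bimonomial_sum.monom[of c 0 0] by simp
next
  case (add f g)
  then show ?case by (intro bimonomial_sum.add)
next
  case (mult f g)
  then show ?case by (intro bimonomial_sum_mult)
qed

text \<open>Determinacy of the moment problem on a compact square: polynomials approximate
  continuous functions uniformly there, and indicators of closed sets are decreasing limits of
  continuous functions.\<close>

lemma finite_measure_eqI_moments:
  fixes \<mu> \<nu> :: "(real \<times> real) measure"
  assumes sets: "sets \<mu> = sets borel" "sets \<nu> = sets borel"
    and fin: "finite_measure \<mu>" "finite_measure \<nu>"
    and supp: "AE z in \<mu>. z \<in> cbox 0 (1, 1)" "AE z in \<nu>. z \<in> cbox 0 (1, 1)"
    and mom: "\<And>m n. (\<integral>z. fst z ^ m * snd z ^ n \<partial>\<mu>) = (\<integral>z. fst z ^ m * snd z ^ n \<partial>\<nu>)"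
  shows "\<mu> = \<nu>"
proof -
  note [measurable_cong] = sets
  have bdd: "integrable M f" if M: "M = \<mu> \<or> M = \<nu>" and f: "f \<in> borel_measurable borel"
    and B: "\<And>z. z \<in> cbox 0 (1, 1) \<Longrightarrow> \<bar>f z\<bar> \<le> B" for M and f :: "real \<times> real \<Rightarrow> real" and B
  proof -
    have "finite_measure M" "sets M = sets borel" "AE z in M. z \<in> cbox 0 (1, 1)"
      using M fin sets supp by auto
    then show ?thesis
      using f B by (intro finite_measure.integrable_const_bound[where B=B])
        (auto elim!: eventually_mono cong: measurable_cong_sets)
  qed
  have cont_int: "integrable M f" if M: "M = \<mu> \<or> M = \<nu>" and f: "continuous_on UNIV f"
    for M and f :: "real \<times> real \<Rightarrow> real"
  proof -
    have "compact (f ` cbox 0 (1, 1))"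
      using f by (intro compact_continuous_image) (auto intro: continuous_on_subset)
    then obtain B where "\<forall>x \<in> f ` cbox 0 (1, 1). norm x \<le> B"
      using compact_imp_bounded bounded_iff by metis
    then show ?thesis using f by (intro bdd[OF M, of _ B] borel_measurable_continuous_onI) auto
  qed
  have mono_cont: "continuous_on UNIV p" if "bimonomial_sum p" for p
    using that by induction (auto intro!: continuous_intros)
  have poly: "(\<integral>z. p z \<partial>\<mu>) = (\<integral>z. p z \<partial>\<nu>)" if "bimonomial_sum p" for p
    using that
  proof induction
    case (monom c m n)
    then show ?case using mom[of m n] by simp
  next
    case (add p q)
    have "integrable \<mu> p" "integrable \<mu> q" "integrable \<nu> p" "integrable \<nu> q"
      using add.hyps by (auto intro!: cont_int mono_cont)
    then show ?case using add.IH by simp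
  qed
  have cont: "(\<integral>z. f z \<partial>\<mu>) = (\<integral>z. f z \<partial>\<nu>)" if f: "continuous_on UNIV f" for f :: "real \<times> real \<Rightarrow> real"
  proof -
    define C where "C = measure \<mu> (space \<mu>) + measure \<nu> (space \<nu>)"
    have "\<bar>(\<integral>z. f z \<partial>\<mu>) - (\<integral>z. f z \<partial>\<nu>)\<bar> \<le> 0"
    proof (rule field_le_epsilon)
      fix \<epsilon> :: real assume \<epsilon>: "\<epsilon> > 0"
      define \<delta> where "\<delta> = \<epsilon> / (C + 1)"
      have C: "C \<ge> 0" by (simp add: C_def)
      then have \<delta>: "\<delta> > 0" using \<epsilon> by (simp add: \<delta>_def)
      obtain g where g: "real_polynomial_function g" "\<And>z. z \<in> cbox 0 (1, 1) \<Longrightarrow> \<bar>f z - g z\<bar> < \<delta>"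
        using Stone_Weierstrass_real_polynomial_function[of "cbox 0 (1, 1)" f \<delta>] f \<delta>
        by (metis compact_cbox continuous_on_subset subset_UNIV)
      have bg: "bimonomial_sum g" by (rule real_polynomial_function_bimonomial_sum[OF g(1)])
      have est: "\<bar>(\<integral>z. f z \<partial>M) - (\<integral>z. g z \<partial>M)\<bar> \<le> \<delta> * measure M (space M)" if M: "M = \<mu> \<or> M = \<nu>" for M
      proof -
        interpret finite_measure M using M fin by auto
        have i: "integrable M f" "integrable M g" using M f mono_cont[OF bg] by (auto intro!: cont_int)
        have "AE z in M. z \<in> cbox 0 (1, 1)" using M supp by auto
        then have ae: "AE z in M. \<bar>f z - g z\<bar> \<le> \<delta>" using g(2) by (auto elim!: eventually_mono intro: less_imp_le)
        have "\<bar>(\<integral>z. f z \<partial>M) - (\<integral>z. g z \<partial>M)\<bar> = \<bar>(\<integral>z. f z - g z \<partial>M)\<bar>" using i by simp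
        also have "\<dots> \<le> (\<integral>z. \<bar>f z - g z\<bar> \<partial>M)" by (rule integral_abs_bound)
        also have "\<dots> \<le> (\<integral>z. \<delta> \<partial>M)" using i ae by (intro integral_mono_AE) auto
        finally show ?thesis by (simp add: mult.commute)
      qed
      have "\<bar>(\<integral>z. f z \<partial>\<mu>) - (\<integral>z. f z \<partial>\<nu>)\<bar> \<le> \<delta> * C"
        using est[of \<mu>] est[of \<nu>] poly[OF bg] by (simp add: C_def distrib_left)
      also have "\<dots> \<le> \<delta> * (C + 1)" using \<delta> by simp
      also have "\<dots> = \<epsilon>" using C by (simp add: \<delta>_def)
      finally show "\<bar>(\<integral>z. f z \<partial>\<mu>) - (\<integral>z. f z \<partial>\<nu>)\<bar> \<le> 0 + \<epsilon>" by simp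
    qed
    then show ?thesis by simp
  qed
  have closed_eq: "measure \<mu> K = measure \<nu> K" if K: "closed K" for K
  proof (cases "K = {}")
    case False
    define f where "f n z = max 0 (1 - real n * infdist z K)" for n and z :: "real \<times> real"
    have fc: "continuous_on UNIV (f n)" for n unfolding f_def by (intro continuous_intros)
    have f1: "norm (f n z) \<le> 1" for n z by (auto simp: f_def infdist_nonneg)
    have lim: "(\<lambda>n. f n z) \<longlonglongrightarrow> indicator K z" for z
    proof (cases "z \<in> K")
      case True then show ?thesis by (simp add: f_def)
    next
      case zK: False
      then have pos: "infdist z K > 0" using K False by (simp add: in_closed_iff_infdist_zero infdist_nonneg less_le)
      then obtain N where N: "1 < real N * infdist z K" using ex_less_of_nat_mult by blast
      have "f n z = 0" if "n \<ge> N" for n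
      proof -
        have "real N * infdist z K \<le> real n * infdist z K" using that pos by (intro mult_right_mono) auto
        then show ?thesis using N by (simp add: f_def)
      qed
      then have "eventually (\<lambda>n. f n z = indicator K z) sequentially"
        using zK by (auto simp: eventually_sequentially)
      then show ?thesis by (rule tendsto_eventually)
    qed
    have "(\<lambda>n. \<integral>z. f n z \<partial>M) \<longlonglongrightarrow> measure M K" if M: "M = \<mu> \<or> M = \<nu>" for M
    proof -
      interpret finite_measure M using M fin by auto
      have sM[measurable_cong]: "sets M = sets borel" using M sets by auto
      have KM: "K \<in> sets M" using K sM by auto
      have fm: "f n \<in> borel_measurable M" for n
        using borel_measurable_continuous_onI[OF fc] by measurable
      have "(\<lambda>n. \<integral>z. f n z \<partial>M) \<longlonglongrightarrow> (\<integral>z. indicator K z \<partial>M)"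
        by (rule integral_dominated_convergence[where w="\<lambda>_. 1"])
          (use lim KM fm f1 in \<open>simp_all\<close>)
      then show ?thesis using KM by (simp add: sets.Int_space_eq2)
    qed
    from this[of \<mu>] this[of \<nu>] show ?thesis
      using cont[OF fc] LIMSEQ_unique by auto
  qed simp
  show ?thesis
  proof (rule measure_eqI_generator_eq[where E="{K. closed K}" and \<Omega>=UNIV and A="\<lambda>_. UNIV"])
    show "Int_stable {K :: (real \<times> real) set. closed K}" by (auto simp: Int_stable_def)
    show "sets \<mu> = sigma_sets UNIV {K. closed K}" "sets \<nu> = sigma_sets UNIV {K. closed K}"
      using sets by (simp_all add: borel_eq_closed)
    fix K :: "(real \<times> real) set" assume "K \<in> {K. closed K}"
    then show "emeasure \<mu> K = emeasure \<nu> K"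
      using closed_eq fin by (simp add: finite_measure.emeasure_eq_measure)
  qed (use fin in \<open>auto simp: finite_measure.emeasure_finite\<close>)
qed

text \<open>The substitution \<open>(exp (-x), exp (-y))\<close> makes the values at positive
  integers moments on the unit square. So, with density \<open>exp (-(x+y))\<close>, the measure on
  \<open>E\<close> equals \<open>c\<close> times that on the quadrant; testing it on
  \<open>E\<close> itself gives \<open>c = c*c\<close>.\<close>

lemma laplace2_unique:
  assumes E[measurable]: "E \<in> sets borel" and sub: "E \<subseteq> quadrant"
    and c: "0 \<le> c"
    and L: "\<And>a b. a > 0 \<Longrightarrow> b > 0 \<Longrightarrow> laplace2 E a b = ennreal (c/(a*b))"
  shows "E \<in> null_sets lborel \<or> quadrant - E \<in> null_sets lborel"
proof -
  define e where "e w = ennreal (exp (-(fst w + snd w)))" for w :: "real \<times> real"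
  have [measurable]: "e \<in> borel_measurable borel" unfolding e_def by measurable
  define \<psi> where "\<psi> w = (exp (- fst w), exp (- snd w))" for w :: "real \<times> real"
  have \<psi>[measurable]: "\<psi> \<in> borel_measurable borel" unfolding \<psi>_def
    by (intro borel_measurable_continuous_onI continuous_intros)
  define dm where "dm = density lborel (\<lambda>w. indicator E w * e w)"
  define dn where "dn = density lborel (\<lambda>w. ennreal c * (indicator quadrant w * e w))"
  define \<mu> where "\<mu> = distr dm borel \<psi>"
  define \<nu> where "\<nu> = distr dn borel \<psi>"
  have [measurable_cong]: "sets dm = sets borel" "sets dn = sets borel" by (simp_all add: dm_def dn_def)
  have mu: "(\<integral>\<^sup>+z. f z \<partial>\<mu>) = (\<integral>\<^sup>+w. indicator E w * e w * f (\<psi> w) \<partial>lborel)"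
    if [measurable]: "f \<in> borel_measurable borel" for f
    unfolding \<mu>_def by (subst nn_integral_distr) (simp_all add: dm_def nn_integral_density)
  have nu: "(\<integral>\<^sup>+z. f z \<partial>\<nu>) = (\<integral>\<^sup>+w. ennreal c * (indicator quadrant w * e w) * f (\<psi> w) \<partial>lborel)"
    if [measurable]: "f \<in> borel_measurable borel" for f
    unfolding \<nu>_def by (subst nn_integral_distr) (simp_all add: dn_def nn_integral_density)
  \<comment> \<open>The density adds one to each exponent: the moment of order \<open>(m, n)\<close>
    is the transform at \<open>(m+1, n+1)\<close>, so the weights stay positive even for
    \<open>m = n = 0\<close>.\<close>
  have e_pow: "e w * ennreal (fst (\<psi> w) ^ m * snd (\<psi> w) ^ n)
      = ennreal (exp (-(real (Suc m) * fst w + real (Suc n) * snd w)))" for w m n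
    unfolding e_def \<psi>_def
    by (simp add: ennreal_mult[symmetric] exp_add[symmetric] exp_of_nat_mult[symmetric] algebra_simps)
  have nn1: "(\<integral>\<^sup>+z. ennreal (fst z ^ m * snd z ^ n) \<partial>\<mu>) = ennreal (c / (real (Suc m) * real (Suc n)))" for m n
  proof -
    have "(\<integral>\<^sup>+z. ennreal (fst z ^ m * snd z ^ n) \<partial>\<mu>) = laplace2 E (real (Suc m)) (real (Suc n))"
      unfolding laplace2_def by (subst mu) (simp_all only: mult.assoc e_pow, measurable)
    then show ?thesis using L[of "real (Suc m)" "real (Suc n)"] by simp
  qed
  have nn2: "(\<integral>\<^sup>+z. ennreal (fst z ^ m * snd z ^ n) \<partial>\<nu>) = ennreal (c / (real (Suc m) * real (Suc n)))" for m n
  proof -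
    have "(\<integral>\<^sup>+z. ennreal (fst z ^ m * snd z ^ n) \<partial>\<nu>) = ennreal c * laplace2 quadrant (real (Suc m)) (real (Suc n))"
      unfolding laplace2_def
      by (subst nu, measurable, subst nn_integral_cmult[symmetric]) (simp_all only: mult.assoc e_pow, measurable)
    then show ?thesis using laplace2_quadrant[of "real (Suc m)" "real (Suc n)"] c
      by (simp add: ennreal_mult[symmetric])
  qed
  have sets: "sets \<mu> = sets borel" "sets \<nu> = sets borel" by (simp_all add: \<mu>_def \<nu>_def)
  note [measurable_cong] = sets
  have tot: "emeasure \<mu> UNIV = ennreal c" "emeasure \<nu> UNIV = ennreal c"
    using nn1[of 0 0] nn2[of 0 0] by (simp_all add: nn_integral_const[of _ 1, simplified] \<mu>_def \<nu>_def space_distr)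
  have fin: "finite_measure \<mu>" "finite_measure \<nu>"
    using tot by (auto intro!: finite_measureI simp: \<mu>_def \<nu>_def space_distr)
  have box: "\<psi> w \<in> cbox 0 (1, 1)" if "w \<in> quadrant" for w
    using that by (auto simp: \<psi>_def quadrant_def cbox_Pair_eq zero_prod_def)
  have supp: "AE z in \<mu>. z \<in> cbox 0 (1, 1)" "AE z in \<nu>. z \<in> cbox 0 (1, 1)"
  proof -
    have cb: "{z \<in> space borel. z \<in> cbox 0 (1, 1)} \<in> sets (borel :: (real \<times> real) measure)" by simp
    have "AE w in dm. \<psi> w \<in> cbox 0 (1, 1)"
      unfolding dm_def by (subst AE_density) (measurable, use sub box in \<open>auto simp: indicator_def intro!: AE_I2\<close>)
    then show "AE z in \<mu>. z \<in> cbox 0 (1, 1)" unfolding \<mu>_def by (subst AE_distr_iff) (auto simp: cb)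
    have "AE w in dn. \<psi> w \<in> cbox 0 (1, 1)"
      unfolding dn_def by (subst AE_density) (measurable, use sub box in \<open>auto simp: indicator_def intro!: AE_I2\<close>)
    then show "AE z in \<nu>. z \<in> cbox 0 (1, 1)" unfolding \<nu>_def by (subst AE_distr_iff) (auto simp: cb)
  qed
  have quad_pos: "AE z in M. 0 \<le> fst z ^ m * snd z ^ n" if "AE z in M. z \<in> cbox 0 (1, 1)"
    for M :: "(real \<times> real) measure" and m n
    using that by (rule AE_mp) (auto simp: cbox_Pair_eq zero_prod_def)
  have eq: "\<mu> = \<nu>"
  proof (rule finite_measure_eqI_moments[OF sets fin supp])
    fix m n
    show "(\<integral>z. fst z ^ m * snd z ^ n \<partial>\<mu>) = (\<integral>z. fst z ^ m * snd z ^ n \<partial>\<nu>)"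
      using quad_pos[OF supp(1)] quad_pos[OF supp(2)]
      by (subst (1 2) integral_eq_nn_integral) (simp_all add: nn1 nn2)
  qed
  \<comment> \<open>The image of \<open>E\<close> under the injective map \<open>\<psi>\<close>,
    written through its inverse so that it is visibly Borel.\<close>
  define B where "B = {z :: real \<times> real. 0 < fst z \<and> 0 < snd z \<and> (- ln (fst z), - ln (snd z)) \<in> E}"
  have [measurable]: "B \<in> sets borel" unfolding B_def by measurable
  have \<psi>B: "\<psi> w \<in> B \<longleftrightarrow> w \<in> E" for w by (simp add: B_def \<psi>_def)
  define m where "m = (\<integral>\<^sup>+w. indicator E w * e w \<partial>lborel)"
  have "emeasure \<mu> B = m"
  proof -
    have "emeasure \<mu> B = (\<integral>\<^sup>+w. indicator E w * e w * indicator B (\<psi> w) \<partial>lborel)"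
      using mu[of "indicator B"] by simp
    also have "\<dots> = m"
      unfolding m_def by (intro nn_integral_cong) (simp add: indicator_def \<psi>B)
    finally show ?thesis .
  qed
  moreover have "emeasure \<nu> B = ennreal c * m"
  proof -
    have "emeasure \<nu> B = (\<integral>\<^sup>+w. ennreal c * (indicator quadrant w * e w) * indicator B (\<psi> w) \<partial>lborel)"
      using nu[of "indicator B"] by simp
    also have "\<dots> = (\<integral>\<^sup>+w. ennreal c * (indicator E w * e w) \<partial>lborel)"
      using sub by (intro nn_integral_cong) (auto simp: indicator_def \<psi>B)
    finally show ?thesis unfolding m_def by (subst (asm) nn_integral_cmult) auto
  qed
  ultimately have m: "m = ennreal c * m" using eq by simp
  have mL: "m = ennreal c" using L[of 1 1] by (simp add: m_def e_def laplace2_def)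
  then have "ennreal c = ennreal (c * c)" using m c by (simp add: ennreal_mult)
  then have "c = c * c" using c by simp
  then consider "c = 0" | "c = 1" by force
  then show ?thesis
  proof cases
    case 1
    then have "(\<integral>\<^sup>+w. indicator E w * e w \<partial>lborel) = 0" using mL by (simp add: m_def)
    then have "AE w in lborel. indicator E w * e w = 0"
      by (subst (asm) nn_integral_0_iff_AE) auto
    then have "AE w in lborel. w \<notin> E"
      by (rule AE_mp) (auto simp: e_def indicator_def)
    then show ?thesis by (subst (asm) AE_iff_null_sets[symmetric]) auto
  next
    case 2
    then have "ennreal 1 + laplace2 (quadrant - E) 1 1 = ennreal 1 + 0"
      using laplace2_complement[OF E sub, of 1 1] L[of 1 1] by simp
    then have "laplace2 (quadrant - E) 1 1 = 0" by (subst (asm) ennreal_add_left_cancel) auto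
    then have "AE w in lborel. indicator (quadrant - E) w * ennreal (exp (-(1 * fst w + 1 * snd w))) = 0"
      unfolding laplace2_def by (subst (asm) nn_integral_0_iff_AE) auto
    then have "AE w in lborel. w \<notin> quadrant - E"
      by (rule AE_mp) (auto simp: indicator_def)
    then show ?thesis by (subst (asm) AE_iff_null_sets[symmetric]) auto
  qed
qed

section \<open>The projective map\<close>

lemma sort3:
  fixes a b c :: real
  shows "b \<le> c \<Longrightarrow> a \<le> b \<Longrightarrow> sort [a, b, c] = [a, b, c]"
    and "b \<le> c \<Longrightarrow> b \<le> a \<Longrightarrow> a \<le> c \<Longrightarrow> sort [a, b, c] = [b, a, c]"
    and "b \<le> c \<Longrightarrow> c \<le> a \<Longrightarrow> sort [a, b, c] = [b, c, a]"
  by auto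

text \<open>The cases are the three positions that the subtracted entry \<open>x\<close> can take in
  the sorted triple. Leaving the third coordinate \<open>t\<close> free allows direct use in
  homogeneous coordinates.\<close>

lemma S12_proj:
  assumes "0 \<le> x" "x \<le> y" "y \<le> t" "0 < t"
  shows "x \<le> y - x \<Longrightarrow> S12 (x/t, y/t) = (x/(t-x), (y-x)/(t-x))"
    and "y - x \<le> x \<Longrightarrow> x \<le> t - x \<Longrightarrow> S12 (x/t, y/t) = ((y-x)/(t-x), x/(t-x))"
    and "t - x \<le> x \<Longrightarrow> S12 (x/t, y/t) = ((y-x)/x, (t-x)/x)"
proof -
  have l: "[x/t, y/t - x/t, 1 - x/t] = [x/t, (y-x)/t, (t-x)/t]"
    using assms by (simp add: diff_divide_distrib)
  have le: "a/t \<le> b/t \<longleftrightarrow> a \<le> b" for a b using assms by (simp add: divide_le_cancel)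
  have yx: "(y-x)/t \<le> (t-x)/t" using assms by (simp add: le)
  have q: "a/t/(b/t) = a/b" for a b using assms by simp
  show "x \<le> y - x \<Longrightarrow> S12 (x/t, y/t) = (x/(t-x), (y-x)/(t-x))"
    unfolding S12_def T12_def fst_conv snd_conv l
    by (subst sort3(1)[OF yx]) (use assms(4) in \<open>simp_all add: le proj_def q Let_def\<close>)
  show "y - x \<le> x \<Longrightarrow> x \<le> t - x \<Longrightarrow> S12 (x/t, y/t) = ((y-x)/(t-x), x/(t-x))"
    unfolding S12_def T12_def fst_conv snd_conv l
    by (subst sort3(2)[OF yx]) (use assms(4) in \<open>simp_all add: le proj_def q Let_def\<close>)
  show "t - x \<le> x \<Longrightarrow> S12 (x/t, y/t) = ((y-x)/x, (t-x)/x)"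
    unfolding S12_def T12_def fst_conv snd_conv l
    by (subst sort3(3)[OF yx]) (use assms(4) in \<open>simp_all add: le proj_def q Let_def\<close>)
qed

lemma S12_affine:
  assumes "0 \<le> x" "x \<le> y" "y \<le> 1"
  shows "x \<le> y - x \<Longrightarrow> S12 (x, y) = (x/(1-x), (y-x)/(1-x))"
    and "y - x \<le> x \<Longrightarrow> x \<le> 1 - x \<Longrightarrow> S12 (x, y) = ((y-x)/(1-x), x/(1-x))"
    and "1 - x \<le> x \<Longrightarrow> S12 (x, y) = ((y-x)/x, (1-x)/x)"
  using S12_proj[OF assms zero_less_one] by (simp_all only: div_by_1)

lemma S12_cases:
  assumes "z \<in> Bset"
  obtains (1) x y where "z = (x, y)" "0 \<le> x" "x \<le> y" "y \<le> 1" "x \<le> y - x" "1 - x > 0" "S12 z = (x/(1-x), (y-x)/(1-x))"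
  | (2) x y where "z = (x, y)" "0 \<le> x" "x \<le> y" "y \<le> 1" "y - x \<le> x" "x \<le> 1 - x" "1 - x > 0" "S12 z = ((y-x)/(1-x), x/(1-x))"
  | (3) x y where "z = (x, y)" "0 \<le> x" "x \<le> y" "y \<le> 1" "1 - x \<le> x" "x > 0" "S12 z = ((y-x)/x, (1-x)/x)"
proof -
  obtain x y where z: "z = (x, y)" by (cases z)
  have xy: "0 \<le> x" "x \<le> y" "y \<le> 1" using assms by (auto simp: z Bset_def)
  consider "x \<le> y - x" "1 - x > 0" | "y - x \<le> x" "x \<le> 1 - x" "1 - x > 0" | "1 - x \<le> x" "x > 0"
    using xy by linarith
  then show ?thesis
  proof cases
    case 1
    show ?thesis by (rule that(1)[OF z xy 1]) (simp only: z S12_affine(1)[OF xy 1(1)])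
  next
    case 2
    show ?thesis by (rule that(2)[OF z xy 2]) (simp only: z S12_affine(2)[OF xy 2(1,2)])
  next
    case 3
    show ?thesis by (rule that(3)[OF z xy 3]) (simp only: z S12_affine(3)[OF xy 3(1)])
  qed
qed

lemma S12_in_Bset: "z \<in> Bset \<Longrightarrow> S12 z \<in> Bset"
  by (erule S12_cases) (auto simp: Bset_def divide_right_mono)

lemma funpow_S12_in_Bset: "z \<in> Bset \<Longrightarrow> (S12 ^^ n) z \<in> Bset"
  by (induction n) (auto simp: S12_in_Bset)

lemma closed_Bset: "closed Bset"
proof -
  have eq: "Bset = {z. 0 \<le> fst z} \<inter> {z. fst z \<le> snd z} \<inter> {z. snd z \<le> 1}" by (auto simp: Bset_def)
  show ?thesis unfolding eq by (intro closed_Int closed_Collect_le continuous_intros)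
qed

lemma Bset_borel [measurable]: "Bset \<in> sets borel"
  using closed_Bset by (rule borel_closed)

text \<open>To undo the map it suffices to know which position the subtracted entry took. The three
  resulting branches are smooth on \<open>Bset\<close>, so preimages of null sets are null.\<close>

lemma S12_inverse_branches:
  assumes "z \<in> Bset" and u: "u = S12 z"
  shows "z = (fst u / (1 + fst u), (fst u + snd u) / (1 + fst u)) \<or>
    z = (snd u / (1 + snd u), (fst u + snd u) / (1 + snd u)) \<or>
    z = (1 / (1 + snd u), (1 + fst u) / (1 + snd u))"
  using assms(1)
proof (cases rule: S12_cases)
  case (1 x y)
  then have "1 + x/(1-x) = 1/(1-x)" by (simp add: field_simps)
  then show ?thesis using 1 u by (simp add: add_divide_distrib[symmetric])
next
  case (2 x y)
  then have "1 + x/(1-x) = 1/(1-x)" by (simp add: field_simps)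
  then show ?thesis using 2 u by (simp add: add_divide_distrib[symmetric])
next
  case (3 x y)
  then have "1 + (1-x)/x = 1/x" "1 + (y-x)/x = y/x" by (simp_all add: field_simps)
  then show ?thesis using 3 u by simp
qed

lemma differentiable_fst_snd:
  "fst differentiable (at x within S)" "snd differentiable (at x within S)"
  by (simp_all add: bounded_linear_imp_differentiable bounded_linear_fst bounded_linear_snd)

lemma negligible_S12_vimage:
  assumes "negligible A"
  shows "negligible (S12 -` A \<inter> Bset)"
proof -
  define f1 f2 f3 :: "real \<times> real \<Rightarrow> real \<times> real" where
    "f1 u = (fst u / (1 + fst u), (fst u + snd u) / (1 + fst u))" and
    "f2 u = (snd u / (1 + snd u), (fst u + snd u) / (1 + snd u))" and
    "f3 u = (1 / (1 + snd u), (1 + fst u) / (1 + snd u))" for u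
  have neg: "negligible (A \<inter> Bset)" using assms by (rule negligible_subset) auto
  have "f1 differentiable_on (A \<inter> Bset)" "f2 differentiable_on (A \<inter> Bset)" "f3 differentiable_on (A \<inter> Bset)"
    unfolding f1_def f2_def f3_def differentiable_on_def
    by (auto intro!: derivative_intros differentiable_fst_snd simp: Bset_def)
  then have "negligible (f1 ` (A \<inter> Bset) \<union> f2 ` (A \<inter> Bset) \<union> f3 ` (A \<inter> Bset))"
    using neg by (intro negligible_Un negligible_differentiable_image_negligible) auto
  moreover have "S12 -` A \<inter> Bset \<subseteq> f1 ` (A \<inter> Bset) \<union> f2 ` (A \<inter> Bset) \<union> f3 ` (A \<inter> Bset)"
  proof
    fix z assume "z \<in> S12 -` A \<inter> Bset"
    then have z: "S12 z \<in> A \<inter> Bset" "z \<in> Bset" by (auto simp: S12_in_Bset)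
    have "z = f1 (S12 z) \<or> z = f2 (S12 z) \<or> z = f3 (S12 z)"
      unfolding f1_def f2_def f3_def by (rule S12_inverse_branches[OF z(2) refl])
    then show "z \<in> f1 ` (A \<inter> Bset) \<union> f2 ` (A \<inter> Bset) \<union> f3 ` (A \<inter> Bset)" using z(1) by blast
  qed
  ultimately show ?thesis by (rule negligible_subset)
qed

lemma negligible_funpow_S12_vimage:
  assumes "negligible A"
  shows "negligible ((S12 ^^ n) -` A \<inter> Bset)"
proof (induction n)
  case 0
  show ?case using negligible_subset[OF assms] by simp
next
  case (Suc n)
  have "(S12 ^^ Suc n) -` A \<inter> Bset = S12 -` ((S12 ^^ n) -` A \<inter> Bset) \<inter> Bset"
    by (auto simp: funpow_swap1 S12_in_Bset)
  then show ?case using negligible_S12_vimage[OF Suc] by (simp only:)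
qed

lemma S12_vimage_borel:
  assumes [measurable]: "A \<in> sets borel"
  shows "S12 -` A \<inter> Bset \<in> sets borel"
proof -
  define g :: "real \<times> real \<Rightarrow> real \<times> real" where "g z =
    (if fst z \<le> snd z - fst z then (fst z / (1 - fst z), (snd z - fst z) / (1 - fst z))
     else if fst z \<le> 1 - fst z then ((snd z - fst z) / (1 - fst z), fst z / (1 - fst z))
     else ((snd z - fst z) / fst z, (1 - fst z) / fst z))" for z
  have [measurable]: "g \<in> borel_measurable borel" unfolding g_def by measurable
  have "S12 z = g z" if "z \<in> Bset" for z
  proof -
    obtain x y where z: "z = (x, y)" by (cases z)
    have xy: "0 \<le> x" "x \<le> y" "y \<le> 1" using that by (auto simp: z Bset_def)
    show ?thesis using S12_affine[OF xy] by (auto simp: z g_def)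
  qed
  then have "S12 -` A \<inter> Bset = (g -` A \<inter> space borel) \<inter> Bset" by auto
  then show ?thesis by simp
qed

lemma funpow_S12_vimage_borel:
  assumes "A \<in> sets borel"
  shows "(S12 ^^ n) -` A \<inter> Bset \<in> sets borel"
proof (induction n)
  case 0
  show ?case using assms by simp
next
  case (Suc n)
  have "(S12 ^^ Suc n) -` A \<inter> Bset = S12 -` ((S12 ^^ n) -` A \<inter> Bset) \<inter> Bset"
    by (auto simp: funpow_swap1 S12_in_Bset)
  then show ?case using S12_vimage_borel[OF Suc] by (simp only:)
qed

text \<open>Borel measurability alone does not pass to the completion; the null part of
  \<open>A\<close> is handled by nonsingularity.\<close>

lemma S12_vimage_lebesgue:
  assumes "A \<in> sets lebesgue"
  shows "S12 -` A \<inter> Bset \<in> sets lebesgue"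
proof -
  obtain C N N' where A: "A = C \<union> N" "N \<subseteq> N'" "N' \<in> null_sets lborel" "C \<in> sets lborel"
    using assms by (rule sets_completionE)
  have "negligible N'" using A(3) by (simp add: negligible_iff_null_sets null_sets_completionI)
  then have "negligible (S12 -` N \<inter> Bset)" using A(2) by (meson negligible_S12_vimage negligible_subset)
  then have "S12 -` N \<inter> Bset \<in> sets lebesgue" by (rule negligible_imp_sets)
  moreover have "S12 -` C \<inter> Bset \<in> sets lebesgue" using S12_vimage_borel[of C] A(4) by simp
  moreover have "S12 -` A \<inter> Bset = (S12 -` C \<inter> Bset) \<union> (S12 -` N \<inter> Bset)" using A(1) by auto
  ultimately show ?thesis by simp
qed

lemma space_lebB [simp]: "space lebB = Bset"
  by (simp add: lebB_def)

lemma sets_lebB: "A \<in> sets lebB \<longleftrightarrow> A \<in> sets lebesgue \<and> A \<subseteq> Bset"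
  unfolding lebB_def by (subst sets_restrict_space_iff) auto

lemma null_lebB:
  assumes "A \<in> sets lebB"
  shows "emeasure lebB A = 0 \<longleftrightarrow> negligible A"
proof -
  have A: "A \<in> sets lebesgue" "A \<subseteq> Bset" using assms by (auto simp: sets_lebB)
  have "emeasure lebB A = emeasure lebesgue A"
    unfolding lebB_def using A by (intro emeasure_restrict_space) auto
  then show ?thesis using A by (simp add: negligible_iff_null_sets null_sets_def)
qed

lemma nonsingular_S12: "nonsingular lebB S12"
  unfolding nonsingular_def
proof (intro conjI ballI impI measurableI)
  fix A assume A: "A \<in> sets lebB"
  show AS: "S12 -` A \<inter> space lebB \<in> sets lebB"
    using A S12_vimage_lebesgue by (auto simp: sets_lebB)
  assume "emeasure lebB A = 0"
  then show "emeasure lebB (S12 -` A \<inter> space lebB) = 0"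
    using negligible_S12_vimage null_lebB[OF A] null_lebB[OF AS] by simp
qed (simp add: S12_in_Bset)

text \<open>For \<open>c = 1\<close> this is the absorbing region \<open>x\<^sub>1 + x\<^sub>2 \<le> x\<^sub>3\<close>, on which \<open>x\<^sub>3 - x\<^sub>1 - x\<^sub>2\<close> is preserved and \<open>T\<^sub>1\<^sub>2\<close> acts on \<open>(x\<^sub>1, x\<^sub>2)\<close> as the
  subtractive Euclidean algorithm.\<close>
definition Dset :: "real \<Rightarrow> (real \<times> real) set" where
  "Dset c = {z \<in> Bset. fst z + snd z \<le> c}"

lemma Dset_borel [measurable]: "Dset c \<in> sets borel"
proof -
  have eq: "Dset c = Bset \<inter> {z. fst z + snd z \<le> c}" by (auto simp: Dset_def)
  show ?thesis
    unfolding eq by (intro borel_closed closed_Int closed_Bset closed_Collect_le continuous_intros)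
qed

text \<open>In either order of the image the new sum is \<open>y/(1-x)\<close>, and
  \<open>(x+y)*(1-x) - y = x*(1-x-y)\<close>.\<close>

lemma S12_sum:
  assumes "z \<in> Dset 1"
  shows "fst (S12 z) + snd (S12 z) \<le> fst z + snd z"
    and "0 < fst z \<Longrightarrow> fst z + snd z < 1 \<Longrightarrow> fst (S12 z) + snd (S12 z) < fst z + snd z"
proof -
  obtain x y where z: "z = (x, y)" by (cases z)
  have xy: "0 \<le> x" "x \<le> y" "y \<le> 1" "x + y \<le> 1" using assms by (auto simp: z Dset_def Bset_def)
  have x1: "x \<le> 1 - x" "1 - x > 0" using xy by linarith+
  have s: "fst (S12 z) + snd (S12 z) = y/(1-x)"
    using S12_affine(1,2)[OF xy(1-3)] x1
    by (cases "x \<le> y - x") (auto simp: z add_divide_distrib[symmetric])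
  have e: "(x+y)*(1-x) = y + x*(1-x-y)" by (simp add: algebra_simps)
  have "x*(1-x-y) \<ge> 0" using xy by simp
  then show "fst (S12 z) + snd (S12 z) \<le> fst z + snd z"
    unfolding s using x1 e by (simp add: z pos_divide_le_eq)
  assume "0 < fst z" "fst z + snd z < 1"
  then have "x*(1-x-y) > 0" by (simp add: z)
  then show "fst (S12 z) + snd (S12 z) < fst z + snd z"
    unfolding s using x1 e by (simp add: z pos_divide_less_eq)
qed

lemma S12_Dset: "c \<le> 1 \<Longrightarrow> z \<in> Dset c \<Longrightarrow> S12 z \<in> Dset c"
  using S12_sum(1)[of z] S12_in_Bset[of z] by (auto simp: Dset_def)

definition never_absorbed :: "(real \<times> real) set" where
  "never_absorbed = {z \<in> Bset. \<forall>n. (S12 ^^ n) z \<notin> Dset 1}"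

lemma never_absorbed_borel [measurable]: "never_absorbed \<in> sets borel"
proof -
  have eq: "never_absorbed = Bset - (\<Union>n. (S12 ^^ n) -` Dset 1 \<inter> Bset)"
    unfolding never_absorbed_def by blast
  show ?thesis
    unfolding eq
    by (intro sets.Diff Bset_borel sets.countable_UN image_subsetI funpow_S12_vimage_borel Dset_borel)
qed

lemma S12_never_absorbed:
  assumes "z \<in> never_absorbed"
  shows "S12 z \<in> never_absorbed"
proof -
  have "(S12 ^^ Suc n) z \<notin> Dset 1" for n using assms unfolding never_absorbed_def by blast
  then show ?thesis using assms by (simp add: never_absorbed_def S12_in_Bset funpow_swap1)
qed

section \<open>Absorption and dissipativity\<close>

text \<open>The pair sums of \<open>y\<close> in increasing order, in the affine chart. In the coordinates \<open>y\<close>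
  the map becomes ``subtract the two smaller entries from the largest''.\<close>
definition pair_sums :: "real \<times> real \<times> real \<Rightarrow> real \<times> real" where
  "pair_sums y = (let s = fst y + fst (snd y) + snd (snd y);
      M = max (fst y) (max (fst (snd y)) (snd (snd y)));
      m = min (fst y) (min (fst (snd y)) (snd (snd y)))
    in ((s - M)/(s - m), (M + m)/(s - m)))"

lemma pair_sums_swap:
  "pair_sums (y, x, z) = pair_sums (x, y, z)" "pair_sums (x, z, y) = pair_sums (x, y, z)"
proof -
  have "x + z + y = x + y + z" "y + x + z = x + y + z" by simp_all
  then show "pair_sums (y, x, z) = pair_sums (x, y, z)" "pair_sums (x, z, y) = pair_sums (x, y, z)"
    unfolding pair_sums_def fst_conv snd_conv max.left_commute[of y x z] min.left_commute[of y x z]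
      max.commute[of z y] min.commute[of z y]
    by (simp_all only:)
qed

lemma pair_sums_sorted:
  assumes "x \<le> y" "y \<le> z"
  shows "pair_sums (x, y, z) = ((x+y)/(y+z), (x+z)/(y+z))"
  using assms by (simp add: pair_sums_def Let_def max_def min_def algebra_simps)

text \<open>Subtracting the smallest of \<open>y+z\<close>, \<open>x+z\<close>, \<open>x+y\<close>
  leaves \<open>y+z\<close>, \<open>x-y\<close>, \<open>x-z\<close>, the pair sums of
  \<open>(x-y-z, y, z)\<close>. The case split only locates \<open>x-y-z\<close> in the
  order.\<close>

lemma S12_pair_sums:
  assumes "y > 0" "z > 0" "x > y + z"
  shows "S12 (pair_sums (x, y, z)) = pair_sums (x - y - z, y, z)"
proof -
  have main: "S12 (pair_sums (x, y, z)) = pair_sums (x - y - z, y, z)"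
    if "y > 0" "y \<le> z" "x > y + z" for x y z
  proof -
    have p: "pair_sums (x, y, z) = ((y+z)/(x+z), (x+y)/(x+z))"
      using pair_sums_sorted[of y z x] that by (simp add: pair_sums_swap add.commute)
    have h: "0 \<le> y+z" "y+z \<le> x+y" "x+y \<le> x+z" "0 < x+z" using that by auto
    consider "z \<le> x-y-z" | "y \<le> x-y-z" "x-y-z \<le> z" | "x-y-z \<le> y" by linarith
    then show ?thesis
    proof cases
      case 1
      have "pair_sums (x-y-z, y, z) = pair_sums (y, z, x-y-z)" by (simp add: pair_sums_swap)
      then show ?thesis
        using S12_proj(1)[OF h] pair_sums_sorted[of y z "x-y-z"] 1 that by (simp add: p)
    next
      case 2
      have "pair_sums (x-y-z, y, z) = pair_sums (y, x-y-z, z)" by (simp add: pair_sums_swap)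
      then show ?thesis
        using S12_proj(2)[OF h] pair_sums_sorted[of y "x-y-z" z] 2 that by (simp add: p)
    next
      case 3
      then show ?thesis
        using S12_proj(3)[OF h] pair_sums_sorted[of "x-y-z" y z] that by (simp add: p)
    qed
  qed
  show ?thesis
  proof (cases "y \<le> z")
    case True then show ?thesis using main assms by auto
  next
    case False
    then have "S12 (pair_sums (x, z, y)) = pair_sums (x - z - y, z, y)"
      using assms by (intro main) auto
    moreover have "x - z - y = x - y - z" by simp
    ultimately show ?thesis by (simp add: pair_sums_swap)
  qed
qed

lemma pair_sums_in_Bset:
  assumes "0 < x" "x \<le> y" "y \<le> z"
  shows "pair_sums (x, y, z) \<in> Bset"
  unfolding pair_sums_sorted[OF assms(2,3)] using assms
  by (auto simp: Bset_def divide_right_mono)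

text \<open>Subtracting \<open>x+y\<close> leaves \<open>z-y\<close>, \<open>z-x\<close> and
  \<open>x+y\<close>, and the first two add up to at most the third exactly when
  \<open>z \<le> x+y\<close>.\<close>

lemma S12_pair_sums_absorbed:
  assumes "0 < x" "x \<le> y" "y \<le> z" "z \<le> x + y"
  shows "S12 (pair_sums (x, y, z)) \<in> Dset 1"
proof -
  have h: "0 \<le> x+y" "x+y \<le> x+z" "x+z \<le> y+z" "0 < y+z" using assms by auto
  have "S12 (pair_sums (x, y, z)) = ((z-y)/(x+y), (z-x)/(x+y))"
    unfolding pair_sums_sorted[OF assms(2,3)] using S12_proj(3)[OF h] assms by simp
  moreover have "(z-y)/(x+y) + (z-x)/(x+y) \<le> 1"
    unfolding add_divide_distrib[symmetric] using assms by (simp add: pos_divide_le_eq)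
  ultimately show ?thesis
    using S12_in_Bset[OF pair_sums_in_Bset[OF assms(1-3)]] by (simp add: Dset_def)
qed

text \<open>The null set \<open>G\<close> in space is brought down to the plane by the smooth map
  \<open>\<Phi>\<close>, which records a projective point together with a scale. Its image contains
  the product of \<open>never_absorbed\<close> with an interval of positive length, so the first
  factor is null.\<close>

lemma negligible_never_absorbed: "negligible never_absorbed"
proof -
  define G where "G = {y \<in> octant. pair_sums y \<in> never_absorbed}"
  have G_iff: "(x, y, z) \<in> G \<longleftrightarrow> x > 0 \<and> y > 0 \<and> z > 0 \<and> pair_sums (x, y, z) \<in> never_absorbed" for x y z
    by (auto simp: G_def octant_def)
  have oct: "octant \<in> sets borel" unfolding octant_def by (intro borel_open open_Times) auto
  have ps: "pair_sums \<in> borel_measurable borel" unfolding pair_sums_def Let_def by measurable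
  have "G = octant \<inter> (pair_sums -` never_absorbed \<inter> space borel)" by (auto simp: G_def)
  then have G[measurable]: "G \<in> sets borel" using oct measurable_sets[OF ps never_absorbed_borel] by simp
  have dom: "x > y + z \<or> y > x + z \<or> z > x + y" if "(x, y, z) \<in> G" for x y z
  proof (rule ccontr)
    assume neg: "\<not> ?thesis"
    have key: False if "(x, y, z) \<in> G" "x \<le> y" "y \<le> z" "z \<le> x + y" for x y z
    proof -
      have "S12 (pair_sums (x, y, z)) \<in> Dset 1" using that by (intro S12_pair_sums_absorbed) (auto simp: G_iff)
      moreover have "S12 (pair_sums (x, y, z)) \<in> never_absorbed"
        using that by (intro S12_never_absorbed) (auto simp: G_iff)
      then have "(S12 ^^ 0) (S12 (pair_sums (x, y, z))) \<notin> Dset 1" unfolding never_absorbed_def by blast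
      ultimately show False by simp
    qed
    consider "x \<le> y \<and> y \<le> z" | "x \<le> z \<and> z \<le> y" | "y \<le> x \<and> x \<le> z" | "y \<le> z \<and> z \<le> x"
      | "z \<le> x \<and> x \<le> y" | "z \<le> y \<and> y \<le> x" by linarith
    then show False
      using that neg key[of x y z] key[of x z y] key[of y x z] key[of y z x] key[of z x y] key[of z y x]
      by cases (auto simp: G_iff pair_sums_swap)
  qed
  have "G \<in> null_sets lborel"
  proof (rule gasket_null[OF G])
    show "G \<subseteq> octant" by (auto simp: G_def)
    show "(y, x, z) \<in> G" "(x, z, y) \<in> G" if "(x, y, z) \<in> G" for x y z
      using that by (auto simp: G_iff pair_sums_swap)
    show "x > y + z \<or> y > x + z \<or> z > x + y" if "(x, y, z) \<in> G" for x y z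
      using dom[OF that] .
    show "(x - y - z, y, z) \<in> G" if "(x, y, z) \<in> G" "x > y + z" for x y z
      using that S12_never_absorbed[of "pair_sums (x, y, z)"] by (auto simp: G_iff S12_pair_sums)
  qed
  then have negG: "negligible G" by (simp add: negligible_iff_null_sets null_sets_completionI)
  define \<Phi> :: "real \<times> real \<times> real \<Rightarrow> (real \<times> real) \<times> real" where
    "\<Phi> y = (((fst y + fst (snd y)) / (fst (snd y) + snd (snd y)),
      (fst y + snd (snd y)) / (fst (snd y) + snd (snd y))), fst (snd y) + snd (snd y))" for y
  have "\<Phi> differentiable_on G"
    unfolding \<Phi>_def differentiable_on_def
    by (auto intro!: derivative_intros differentiable_fst_snd differentiable_compose[of fst snd]
         differentiable_compose[of snd snd] simp: G_iff)
  then have negP: "negligible (\<Phi> ` G)"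
    using negG by (intro negligible_differentiable_image_negligible) auto
  have "never_absorbed \<times> {1..2} \<subseteq> \<Phi> ` G"
  proof
    fix p assume "p \<in> never_absorbed \<times> {1..2::real}"
    then obtain z1 z2 t where p: "p = ((z1, z2), t)" and z: "(z1, z2) \<in> never_absorbed" and t: "1 \<le> t" by auto
    have B: "0 \<le> z1" "z1 \<le> z2" "z2 \<le> 1" using z by (auto simp: never_absorbed_def Bset_def)
    have "(S12 ^^ 0) (z1, z2) \<notin> Dset 1" using z unfolding never_absorbed_def by blast
    then have s: "z1 + z2 > 1" using B by (simp add: Dset_def Bset_def)
    \<comment> \<open>The solution of \<open>a+b = t*z1\<close>, \<open>a+c = t*z2\<close>,
      \<open>b+c = t\<close>. Positivity of \<open>a\<close> is \<open>z1 + z2 > 1\<close>, that is,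
      non-absorption at time zero.\<close>
    define a b c where "a = t * (z1 + z2 - 1) / 2" and "b = t * (1 + z1 - z2) / 2" and "c = t * (1 + z2 - z1) / 2"
    have a: "a > 0" unfolding a_def using s t by simp
    have ab: "a \<le> b" "b \<le> c" unfolding a_def b_def c_def using B t by (auto intro!: divide_right_mono mult_left_mono)
    have sums: "a + b = t * z1" "a + c = t * z2" "b + c = t"
      unfolding a_def b_def c_def by (simp_all add: field_simps)
    have "pair_sums (a, b, c) = (z1, z2)"
      unfolding pair_sums_sorted[OF ab] sums using t by simp
    then have "(a, b, c) \<in> G" using a ab z by (simp add: G_iff)
    moreover have "\<Phi> (a, b, c) = p" unfolding \<Phi>_def p fst_conv snd_conv sums using t by simp
    ultimately show "p \<in> \<Phi> ` G" by blast
  qed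
  then have neg: "negligible (never_absorbed \<times> {1..2::real})" using negP by (rule negligible_subset[rotated])
  have "never_absorbed \<times> {1..2::real} \<in> sets (lborel \<Otimes>\<^sub>M lborel)"
    by (intro pair_measureI) simp_all
  then have "never_absorbed \<times> {1..2::real} \<in> sets lborel" by (simp only: lborel_prod)
  then have "never_absorbed \<times> {1..2::real} \<in> null_sets lborel"
    using neg by (simp add: negligible_iff_null_sets null_sets_completion_iff)
  then have "emeasure (lborel \<Otimes>\<^sub>M lborel) (never_absorbed \<times> {1..2::real}) = 0"
    by (simp add: lborel_prod null_sets_def)
  then have "emeasure lborel never_absorbed * emeasure lborel {1..2::real} = 0"
    by (subst (asm) lborel.emeasure_pair_measure_Times) auto
  then have "emeasure lborel never_absorbed = 0" by simp
  then have "never_absorbed \<in> null_sets lborel" by (simp add: null_sets_def)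
  then show ?thesis by (simp add: negligible_iff_null_sets null_sets_completionI)
qed

lemma negligible_Bset_lines:
  "negligible {z \<in> Bset. fst z = 0 \<or> fst z + snd z = 1}"
proof -
  have "negligible {z :: real \<times> real. (1, 0) \<bullet> z = 0}" "negligible {z :: real \<times> real. (1, 1) \<bullet> z = 1}"
    by (auto intro!: negligible_hyperplane simp: zero_prod_def)
  from negligible_Un[OF this] show ?thesis
    by (rule negligible_subset) (auto simp: inner_prod_def)
qed

text \<open>A point never leaves a forward invariant set that it has entered, so the points outside
  \<open>X\<close> about to enter \<open>X\<close> form a wandering set. Countably many
  \<open>X\<close> suffice: rational thresholds for the decreasing sum after absorption, and
  preimages of \<open>Dset 1\<close> for the time of absorption.\<close>

lemma totally_dissipative_S12: "totally_dissipative lebB S12"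
  unfolding totally_dissipative_def
proof (intro conjI nonsingular_S12 ballI impI)
  fix A assume A: "A \<in> sets lebB" and pos: "emeasure lebB A > 0"
  define U where "U = Dset ` (\<rat> \<inter> {..1}) \<union> range (\<lambda>n. (S12 ^^ n) -` Dset 1 \<inter> Bset)"
  have cU: "countable U" unfolding U_def by (intro countable_Un countable_image countable_Int1 countable_rat) auto
  have U_meas: "X \<in> sets borel" if "X \<in> U" for X
    using that by (auto simp: U_def funpow_S12_vimage_borel)
  have U_inv: "S12 z \<in> X" if "X \<in> U" "z \<in> X" for X z
  proof -
    consider c where "c \<le> 1" "X = Dset c" | n where "X = (S12 ^^ n) -` Dset 1 \<inter> Bset"
      using \<open>X \<in> U\<close> by (auto simp: U_def)
    then show ?thesis
    proof cases
      case 1 then show ?thesis using S12_Dset \<open>z \<in> X\<close> by simp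
    next
      case 2
      then have "S12 ((S12 ^^ n) z) \<in> Dset 1" using S12_Dset[of 1] \<open>z \<in> X\<close> by simp
      then show ?thesis using 2 \<open>z \<in> X\<close> by (simp add: funpow_swap1 S12_in_Bset)
    qed
  qed
  define W where "W X = {z \<in> A. z \<notin> X \<and> S12 z \<in> X}" for X
  have AB: "A \<in> sets lebesgue" "A \<subseteq> Bset" using A by (auto simp: sets_lebB)
  have W_meas: "W X \<in> sets lebB" if "X \<in> U" for X
  proof -
    have "X \<in> sets lebesgue" using U_meas[OF that] by simp
    moreover have "W X = A \<inter> (S12 -` X \<inter> Bset) - X" using AB by (auto simp: W_def)
    ultimately show ?thesis using AB S12_vimage_lebesgue[of X] by (auto simp: sets_lebB)
  qed
  \<comment> \<open>The two lines are where the sum need not decrease strictly; together with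
    \<open>never_absorbed\<close> they form a null remainder.\<close>
  have cover: "A \<subseteq> never_absorbed \<union> {z \<in> Bset. fst z = 0 \<or> fst z + snd z = 1} \<union> (\<Union>X\<in>U. W X)"
  proof
    fix z assume zA: "z \<in> A"
    then have zB: "z \<in> Bset" using AB by auto
    show "z \<in> never_absorbed \<union> {z \<in> Bset. fst z = 0 \<or> fst z + snd z = 1} \<union> (\<Union>X\<in>U. W X)"
    proof (cases "z \<in> Dset 1")
      case True
      show ?thesis
      proof (cases "fst z = 0 \<or> fst z + snd z = 1")
        case False
        then have "0 < fst z" "fst z + snd z < 1" using True by (auto simp: Dset_def Bset_def)
        then obtain r where r: "r \<in> \<rat>" "fst (S12 z) + snd (S12 z) < r" "r < fst z + snd z"
          using Rats_dense_in_real S12_sum(2)[OF True] by blast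
        have "Dset r \<in> U" using r True by (auto simp: U_def Dset_def)
        moreover have "z \<in> W (Dset r)" using r zA S12_in_Bset[OF zB] by (auto simp: W_def Dset_def)
        ultimately show ?thesis by blast
      qed (use zB in auto)
    next
      case zD: False
      show ?thesis
      proof (cases "z \<in> never_absorbed")
        case False
        then have ex: "\<exists>n. (S12 ^^ n) z \<in> Dset 1" using zB by (auto simp: never_absorbed_def)
        define n where "n = (LEAST n. (S12 ^^ n) z \<in> Dset 1)"
        have n: "(S12 ^^ n) z \<in> Dset 1" unfolding n_def using ex by (rule LeastI_ex)
        then obtain m where m: "n = Suc m" using zD by (cases n) auto
        have "(S12 ^^ m) z \<notin> Dset 1" using not_less_Least[of m "\<lambda>n. (S12 ^^ n) z \<in> Dset 1"] m unfolding n_def by auto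
        then have "z \<in> W ((S12 ^^ m) -` Dset 1 \<inter> Bset)"
          using n zA S12_in_Bset[OF zB] by (simp add: W_def m funpow_swap1)
        then show ?thesis by (auto simp: U_def)
      qed simp
    qed
  qed
  have "\<exists>X\<in>U. \<not> negligible (W X)"
  proof (rule ccontr)
    assume "\<not> ?thesis"
    then have "negligible (\<Union>X\<in>U. W X)" using cU by (intro negligible_countable_Union) auto
    then have "negligible A"
      using negligible_never_absorbed negligible_Bset_lines by (intro negligible_subset[OF _ cover] negligible_Un)
    then show False using null_lebB[OF A] pos by simp
  qed
  then obtain X where X: "X \<in> U" "\<not> negligible (W X)" by blast
  have "wandering lebB S12 (W X)"
    unfolding wandering_def
  proof (intro conjI W_meas X allI impI)
    fix n :: nat assume "1 \<le> n"
    have fw: "(S12 ^^ Suc m) z \<in> X" if "z \<in> W X" for z m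
      using that by (induction m) (auto simp: W_def U_inv[OF X(1)])
    have "(S12 ^^ n) z \<in> X" if "z \<in> W X" for z
      using fw[OF that, of "n - 1"] \<open>1 \<le> n\<close> by (simp del: funpow.simps)
    then show "W X \<inter> ((S12 ^^ n) -` W X \<inter> space lebB) = {}" by (auto simp: W_def)
  qed
  moreover have "emeasure lebB (W X) > 0"
    using X null_lebB[OF W_meas[OF X(1)]] by (simp add: zero_less_iff_neq_zero)
  ultimately show "\<exists>W. W \<subseteq> A \<and> wandering lebB S12 W \<and> emeasure lebB W > 0"
    by (intro exI[of _ "W X"]) (auto simp: W_def)
qed

section \<open>Ergodicity\<close>

text \<open>The chart of the absorbing region by the invariant cone: \<open>w = (x\<^sub>1, x\<^sub>2) / (x\<^sub>3 - x\<^sub>1 - x\<^sub>2)\<close>,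
  extended symmetrically to unordered pairs.\<close>
definition cone_chart :: "real \<times> real \<Rightarrow> real \<times> real" where
  "cone_chart w = (min (fst w) (snd w) / (1 + fst w + snd w), max (fst w) (snd w) / (1 + fst w + snd w))"

lemma cone_chart_in_Bset: "w \<in> quadrant \<Longrightarrow> cone_chart w \<in> Bset"
  by (auto simp: cone_chart_def quadrant_def Bset_def divide_right_mono pos_divide_le_eq)

lemma cone_chart_swap: "cone_chart (y, x) = cone_chart (x, y)"
  by (simp add: cone_chart_def min.commute max.commute add_ac)

text \<open>The chart picks representatives whose third coordinate is one plus the other two. A step
  takes \<open>(u, u+v, 1+2*u+v)\<close> to \<open>u\<close>, \<open>v\<close>,
  \<open>1+u+v\<close>, again of this form.\<close>

lemma S12_cone_chart:
  assumes "u > 0" "v > 0"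
  shows "S12 (cone_chart (u, u + v)) = cone_chart (u, v)"
proof -
  have h: "0 \<le> u" "u \<le> u + v" "u + v \<le> 1 + u + (u + v)" "0 < 1 + u + (u + v)" using assms by auto
  have c: "cone_chart (u, u + v) = (u / (1 + u + (u + v)), (u + v) / (1 + u + (u + v)))"
    using assms by (simp add: cone_chart_def)
  show ?thesis
  proof (cases "u \<le> v")
    case True
    then show ?thesis using S12_proj(1)[OF h] assms by (simp add: c cone_chart_def)
  next
    case False
    then show ?thesis using S12_proj(2)[OF h] assms by (simp add: c cone_chart_def)
  qed
qed

definition cone_coord :: "real \<times> real \<Rightarrow> real \<times> real" where
  "cone_coord z = (fst z / (1 - fst z - snd z), snd z / (1 - fst z - snd z))"

lemma cone_chart_coord:
  assumes "z \<in> Dset 1" "fst z \<noteq> 0" "fst z + snd z \<noteq> 1"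
  shows "cone_coord z \<in> quadrant" "cone_chart (cone_coord z) = z"
    "fst (cone_coord z) / (1 + fst (cone_coord z) + snd (cone_coord z)) = fst z"
    "snd (cone_coord z) / (1 + fst (cone_coord z) + snd (cone_coord z)) = snd z"
proof -
  obtain x y where z: "z = (x, y)" by (cases z)
  have xy: "0 < x" "x \<le> y" "x + y < 1" using assms by (auto simp: z Dset_def Bset_def)
  define t where "t = 1 - x - y"
  have t: "t > 0" using xy by (simp add: t_def)
  have c: "cone_coord z = (x/t, y/t)" by (simp add: cone_coord_def z t_def)
  show "cone_coord z \<in> quadrant" unfolding c using xy t by (simp add: quadrant_def)
  have "1 + x/t + y/t = (t + x + y)/t" using t by (simp add: field_simps)
  then have s: "1 + x/t + y/t = 1/t" by (simp add: t_def)
  have le: "x/t \<le> y/t" using xy t by (intro divide_right_mono) auto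
  show "cone_chart (cone_coord z) = z"
    unfolding c cone_chart_def fst_conv snd_conv s using le t by (simp add: z)
  show "fst (cone_coord z) / (1 + fst (cone_coord z) + snd (cone_coord z)) = fst z"
    "snd (cone_coord z) / (1 + fst (cone_coord z) + snd (cone_coord z)) = snd z"
    unfolding c fst_conv snd_conv s using t by (simp_all add: z)
qed

lemma cone_coord_chart:
  assumes "w \<in> quadrant"
  shows "cone_coord (cone_chart w) = (min (fst w) (snd w), max (fst w) (snd w))"
    and "fst (cone_chart w) + snd (cone_chart w) < 1"
proof -
  obtain a b where w: "w = (a, b)" by (cases w)
  have ab: "a > 0" "b > 0" using assms by (auto simp: w quadrant_def)
  define m M where "m = min a b" and "M = max a b"
  have mM: "m > 0" "M > 0" "m + M = a + b" using ab by (auto simp: m_def M_def min_def max_def)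
  define s where "s = 1 + m + M"
  have c: "cone_chart w = (m/s, M/s)"
    unfolding cone_chart_def w s_def using mM by (simp add: m_def[symmetric] M_def[symmetric] add.assoc)
  have s: "s > 0" using mM by (simp add: s_def)
  have "1 - m/s - M/s = (s - m - M)/s" using s by (simp add: diff_divide_distrib)
  then have e: "1 - m/s - M/s = 1/s" by (simp add: s_def)
  show "cone_coord (cone_chart w) = (min (fst w) (snd w), max (fst w) (snd w))"
    unfolding c cone_coord_def fst_conv snd_conv e using s by (simp add: w m_def M_def)
  have "1/s > 0" using s by simp
  then show "fst (cone_chart w) + snd (cone_chart w) < 1" unfolding c fst_conv snd_conv e[symmetric] by linarith
qed

text \<open>The chart folds the quadrant along the diagonal, so it has two inverse branches,
  \<open>cone_coord\<close> and its exchange, both smooth where the coordinate sum is below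
  one.\<close>

lemma negligible_cone_chart_vimage:
  assumes "negligible Z"
  shows "negligible {w \<in> quadrant. cone_chart w \<in> Z}"
proof -
  define Z' where "Z' = Z \<inter> {z. fst z + snd z < 1}"
  have "negligible Z'" unfolding Z'_def using assms by (rule negligible_subset) auto
  moreover have "cone_coord differentiable_on Z'" "(\<lambda>z. prod.swap (cone_coord z)) differentiable_on Z'"
    unfolding cone_coord_def differentiable_on_def prod.swap_def fst_conv snd_conv
    by (auto intro!: derivative_intros differentiable_fst_snd simp: Z'_def)
  ultimately have "negligible (cone_coord ` Z' \<union> (\<lambda>z. prod.swap (cone_coord z)) ` Z')"
    by (intro negligible_Un negligible_differentiable_image_negligible) auto
  moreover have "{w \<in> quadrant. cone_chart w \<in> Z} \<subseteq> cone_coord ` Z' \<union> (\<lambda>z. prod.swap (cone_coord z)) ` Z'"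
  proof
    fix w assume "w \<in> {w \<in> quadrant. cone_chart w \<in> Z}"
    then have w: "w \<in> quadrant" "cone_chart w \<in> Z'" using cone_coord_chart(2) by (auto simp: Z'_def)
    have "w = cone_coord (cone_chart w) \<or> w = prod.swap (cone_coord (cone_chart w))"
      unfolding cone_coord_chart(1)[OF w(1)] by (cases w) (auto simp: min_def max_def)
    then show "w \<in> cone_coord ` Z' \<union> (\<lambda>z. prod.swap (cone_coord z)) ` Z'" using w(2) by blast
  qed
  ultimately show ?thesis by (rule negligible_subset)
qed

lemma negligible_AE_lborel: "negligible N \<Longrightarrow> AE x in lborel. x \<notin> N"
  by (metis AE_completion_iff AE_not_in negligible_iff_null_sets)

lemma ergodic_S12: "ergodic_map lebB S12"
  unfolding ergodic_map_def
proof (intro ballI impI)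
  fix E assume E: "E \<in> sets lebB" and "S12 -` E \<inter> space lebB = E"
  then have inv: "S12 z \<in> E \<longleftrightarrow> z \<in> E" if "z \<in> Bset" for z using that by auto
  have EB: "E \<in> sets lebesgue" "E \<subseteq> Bset" using E by (auto simp: sets_lebB)
  \<comment> \<open>\<open>E\<close> is only Lebesgue measurable, while the transform lemmas ask for
    Borel sets: work with the part \<open>C\<close> and keep track of the null discrepancy
    \<open>Z\<close>.\<close>
  obtain C N Z where C: "E = C \<union> N" "N \<subseteq> Z" "Z \<in> null_sets lborel" "C \<in> sets lborel"
    using EB(1) by (rule sets_completionE)
  have Cm[measurable]: "C \<in> sets borel" using C(4) by simp
  have Z: "negligible Z" using C(3) by (simp add: negligible_iff_null_sets null_sets_completionI)
  have CE: "z \<in> C \<longleftrightarrow> z \<in> E" if "z \<notin> Z" for z using C(1,2) that by auto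
  define F where "F = {w \<in> quadrant. cone_chart w \<in> C}"
  have [measurable]: "cone_chart \<in> borel_measurable borel" unfolding cone_chart_def by measurable
  have "F = quadrant \<inter> (cone_chart -` C \<inter> space borel)" by (auto simp: F_def)
  then have F: "F \<in> sets borel" by simp
  have FQ: "F \<subseteq> quadrant" by (auto simp: F_def)
  have Fswap: "(y, x) \<in> F" if "(x, y) \<in> F" for x y
    using that by (auto simp: F_def cone_chart_swap quadrant_def)
  define Y where "Y = {w \<in> quadrant. cone_chart w \<in> Z}"
  have Y: "negligible Y" unfolding Y_def by (rule negligible_cone_chart_vimage[OF Z])
  \<comment> \<open>The points whose shear \<open>(u, u+v)\<close> falls into \<open>Y\<close>;
    outside \<open>Y\<close> and this set, exact invariance of \<open>E\<close> passes to
    \<open>F\<close>.\<close>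
  have Y': "negligible ((\<lambda>w. (fst w, snd w - fst w)) ` Y)"
    using Y by (intro negligible_differentiable_image_negligible)
      (auto simp: differentiable_on_def intro!: derivative_intros differentiable_fst_snd)
  have Finv: "AE u in lborel. u \<in> quadrant \<longrightarrow> ((fst u, fst u + snd u) \<in> F \<longleftrightarrow> u \<in> F)"
    using negligible_AE_lborel[OF Y] negligible_AE_lborel[OF Y']
  proof eventually_elim
    case (elim w)
    show ?case
    proof
      assume w: "w \<in> quadrant"
      obtain u v where uv: "w = (u, v)" "u > 0" "v > 0" using w by (auto simp: quadrant_def)
      have q: "(u, u + v) \<in> quadrant" using uv by (simp add: quadrant_def)
      have "cone_chart (u, v) \<notin> Z" using elim(1) w by (simp add: Y_def uv)
      moreover have "cone_chart (u, u + v) \<notin> Z"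
      proof
        assume "cone_chart (u, u + v) \<in> Z"
        then have "(u, u + v) \<in> Y" using q by (simp add: Y_def)
        then have "w \<in> (\<lambda>w. (fst w, snd w - fst w)) ` Y" by (rule image_eqI[rotated]) (simp add: uv)
        then show False using elim(2) by simp
      qed
      moreover have "cone_chart (u, v) \<in> E \<longleftrightarrow> cone_chart (u, u + v) \<in> E"
        using inv[OF cone_chart_in_Bset[OF q]] S12_cone_chart[OF uv(2,3)] by simp
      ultimately show "((fst w, fst w + snd w) \<in> F \<longleftrightarrow> w \<in> F)"
        using w q CE by (simp add: F_def uv)
    qed
  qed
  obtain c where c: "0 \<le> c" "c \<le> 1" "\<And>a b. a > 0 \<Longrightarrow> b > 0 \<Longrightarrow> laplace2 F a b = ennreal (c/(a*b))"
    by (rule laplace2_invariant_constant[OF F FQ _ Finv]) (erule Fswap, rule that)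
  have "F \<in> null_sets lborel \<or> quadrant - F \<in> null_sets lborel"
    by (rule laplace2_unique[OF F FQ c(1,3)])
  then have dich: "negligible F \<or> negligible (quadrant - F)"
    by (auto simp: negligible_iff_null_sets null_sets_completionI)
  \<comment> \<open>A null lift makes \<open>X\<close> null in the absorbing region by the chart,
    and then everywhere, since almost every orbit is absorbed and preimages of null sets are null. A
    general \<open>X\<close> lets this serve both \<open>E\<close> and its complement.\<close>
  have transfer: "negligible X"
    if X: "X \<subseteq> Bset" "\<And>z. z \<in> Bset \<Longrightarrow> S12 z \<in> X \<longleftrightarrow> z \<in> X"
      and G: "negligible G" "G \<subseteq> quadrant" "\<And>w. w \<in> quadrant \<Longrightarrow> cone_chart w \<in> X - Z \<Longrightarrow> w \<in> G" for X G
  proof -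
    define f where "f w = (fst w / (1 + fst w + snd w), snd w / (1 + fst w + snd w))" for w :: "real \<times> real"
    have "f differentiable_on G"
      unfolding f_def differentiable_on_def using G(2)
      by (auto intro!: derivative_intros differentiable_fst_snd simp: quadrant_def)
    then have fG: "negligible (f ` G)" using G(1) by (intro negligible_differentiable_image_negligible) auto
    have "X \<inter> Dset 1 \<subseteq> {z \<in> Bset. fst z = 0 \<or> fst z + snd z = 1} \<union> Z \<union> f ` G"
    proof
      fix z assume z: "z \<in> X \<inter> Dset 1"
      show "z \<in> {z \<in> Bset. fst z = 0 \<or> fst z + snd z = 1} \<union> Z \<union> f ` G"
      proof (cases "(fst z = 0 \<or> fst z + snd z = 1) \<or> z \<in> Z")
        case True
        then show ?thesis using z X(1) by auto
      next
        case False
        then have nz: "z \<in> Dset 1" "fst z \<noteq> 0" "fst z + snd z \<noteq> 1" using z by auto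
        note cc = cone_chart_coord[OF nz]
        have "cone_coord z \<in> G" using z False cc by (intro G(3)) auto
        moreover have "z = f (cone_coord z)" unfolding f_def cc(3,4) by simp
        ultimately show ?thesis by blast
      qed
    qed
    then have XD: "negligible (X \<inter> Dset 1)"
      by (rule negligible_subset[rotated]) (intro negligible_Un negligible_Bset_lines Z fG)
    have Xn: "(S12 ^^ n) z \<in> X" if "z \<in> X" for z n
      using that X by (induction n) (auto simp: funpow_S12_in_Bset subset_eq)
    have "X \<subseteq> never_absorbed \<union> (\<Union>n. (S12 ^^ n) -` (X \<inter> Dset 1) \<inter> Bset)"
      using X(1) Xn by (auto simp: never_absorbed_def)
    moreover have "negligible (never_absorbed \<union> (\<Union>n. (S12 ^^ n) -` (X \<inter> Dset 1) \<inter> Bset))"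
      by (intro negligible_Un negligible_never_absorbed negligible_Union_nat negligible_funpow_S12_vimage XD)
    ultimately show ?thesis by (rule negligible_subset[rotated])
  qed
  have EC: "space lebB - E \<in> sets lebB" using E by blast
  from dich have "negligible E \<or> negligible (Bset - E)"
  proof
    assume "negligible F"
    then have "negligible E"
      using EB(2) inv FQ CE by (intro transfer[of E F]) (auto simp: F_def)
    then show ?thesis ..
  next
    assume "negligible (quadrant - F)"
    then have "negligible (Bset - E)"
      using inv CE by (intro transfer[of "Bset - E" "quadrant - F"]) (auto simp: F_def S12_in_Bset)
    then show ?thesis ..
  qed
  then show "emeasure lebB E = 0 \<or> emeasure lebB (space lebB - E) = 0"
    using null_lebB[OF E] null_lebB[OF EC] by simp
qed

theorem theorem1p3:
  shows "totally_dissipative lebB S12 \<and> ergodic_map lebB S12"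
  using totally_dissipative_S12 ergodic_S12 by blast

end
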